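(* Let $F:\partial C\to\partial C$ be the return map associated with a domain $\Omega\in\mathcal{O}_C$, and let $d:\partial C\to\mathbb{R}_+$ be the corresponding thickness function, assumed to be of class $C^2$. Then $F$ determines: (1) the critical set of $d$, namely $$\mathrm{Fix}(F)=\mathrm{Crit}(d);$$ (2) the stability type of each fixed point; (3) the basin decomposition of $\partial C$ induced by the dynamics $c_{k+1}=F(c_k)$.
   Context: Convex core. $C\subset\mathbb{R}^N$ is a compact convex set with nonempty interior whose boundary $\partial C$ is a hypersurface of class $C^2$, with the induced Riemannian structure and outward unit normal $\nu(c)$ at $c\in\partial C$. $\nabla_{\partial C}$ is the Riemannian gradient on $\partial C$. Class $\mathcal{O}_C$. An open set $\Omega\subset\mathbb{R}^N$ belongs to $\mathcal{O}_C$ if: (1) $\mathrm{int}(C)\subset\Omega$; (2) $\partial\Omega$ is Lipschitz outside $C$; (3) for every $c\in\partial C$ the ray $\{c+t\nu(c):t\ge 0\}$ intersects $\Omega$ in a connected set; (4) for almost every $x\in\partial\Omega$ at which the inward unit normal $n(x)$ exists, the half-line $\{x+tn(x):t\ge0\}$ intersects $C$. Thickness function: $d(c)=\sup\{r\ge0: c+r\nu(c)\in\Omega\}$. Radial map: $\Phi:\partial C\to\partial\Omega$, $\Phi(c)=c+d(c)\nu(c)$. Reciprocal map: $\pi:\partial\Omega\setminus C\to\partial C$, $\pi(x)=x+t(x)n(x)$, where $n(x)$ is the inward unit normal to $\partial\Omega$ at $x$ and $t(x)$ is the smallest nonnegative number with $x+t(x)n(x)\in C$. Return map: $F=\pi\circ\Phi:\partial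 C\to\partial C$. $\mathrm{Fix}(F)=\{c: F(c)=c\}$ and $\mathrm{Crit}(d)=\{c:\nabla_{\partial C}d(c)=0\}$. The stability type of a fixed point $c^*$ is the one given by the spectrum of $DF(c^* )$ (contraction, expansion or marginal behaviour according to whether eigenvalues have modulus $<1$, $>1$ or $=1$). The basin of a critical point $p$ is $\{c\in\partial C: F^n(c)\to p\}$, and the basin decomposition is the resulting decomposition of $\partial C$. "Determines" means that these objects depend on $d$ only through $F$. *)

theory Defs
  imports "HOL-Analysis.Analysis"
begin

section \<open>Regularity\<close>

definition C2_on :: "'a::euclidean_space set \<Rightarrow> ('a \<Rightarrow> real) \<Rightarrow> bool" where
  "C2_on U f \<longleftrightarrow>
     (\<exists>(g :: 'a \<Rightarrow> 'a) (H :: 'a \<Rightarrow> 'a \<Rightarrow>\<^sub>L 'a).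
        (\<forall>x\<in>U. GDERIV f x :> g x \<and> (g has_derivative blinfun_apply (H x)) (at x)) \<and>
        continuous_on U H)"

text \<open>Embedded hypersurfaces are given locally as regular level sets of functions of class C2.\<close>

definition C2_hypersurface :: "'a::euclidean_space set \<Rightarrow> bool" where
  "C2_hypersurface S \<longleftrightarrow>
     (\<forall>p\<in>S. \<exists>U \<rho>. open U \<and> p \<in> U \<and> C2_on U \<rho> \<and>
        \<not> (GDERIV \<rho> p :> 0) \<and> S \<inter> U = {x \<in> U. \<rho> x = 0})"

text \<open>A function on an embedded hypersurface is of class C2 if it is locally the restriction of
  a function of class C2 on the ambient space; on a C2 hypersurface this agrees with being C2 in
  charts.\<close>

definition C2_on_hypersurface :: "'a::euclidean_space set \<Rightarrow> ('a \<Rightarrow> real) \<Rightarrow> bool" where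
  "C2_on_hypersurface S f \<longleftrightarrow>
     (\<forall>p\<in>S. \<exists>U g. open U \<and> p \<in> U \<and> C2_on U g \<and> (\<forall>x\<in>S \<inter> U. g x = f x))"

text \<open>Near each of its points outside \<open>C\<close>, the frontier of \<open>\<Omega>\<close> is, in suitable orthonormal
  coordinates (\<open>e\<close> is the vertical direction), a Lipschitz graph with \<open>\<Omega>\<close> on one side.\<close>

definition lipschitz_boundary_outside :: "'a::euclidean_space set \<Rightarrow> 'a set \<Rightarrow> bool" where
  "lipschitz_boundary_outside C \<Omega> \<longleftrightarrow>
     (\<forall>x\<in>frontier \<Omega> - C. \<exists>U e \<phi> L. open U \<and> x \<in> U \<and> norm e = 1 \<and>
        L-lipschitz_on {v. v \<bullet> e = 0} (\<phi> :: 'a \<Rightarrow> real) \<and>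
        \<Omega> \<inter> U = {y \<in> U. y \<bullet> e > \<phi> (y - (y \<bullet> e) *\<^sub>R e)})"


section \<open>Hausdorff measure\<close>

text \<open>Hausdorff outer measure without the dimensional normalising constant, which is irrelevant
  for null sets. The empty set is treated separately because \<open>diameter {} ^ 0 = 1\<close>, and
  boundedness is required because \<open>diameter\<close> is unspecified on unbounded sets.\<close>

definition hausdorff_pre :: "nat \<Rightarrow> real \<Rightarrow> 'a::euclidean_space set \<Rightarrow> ennreal" where
  "hausdorff_pre s \<delta> A =
     (INF U \<in> {U :: nat \<Rightarrow> 'a set. A \<subseteq> (\<Union>i. U i) \<and> (\<forall>i. bounded (U i) \<and> diameter (U i) \<le> \<delta>)}.
        \<Sum>i. if U i = {} then 0 else ennreal (diameter (U i) ^ s))"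

definition hausdorff_measure :: "nat \<Rightarrow> 'a::euclidean_space set \<Rightarrow> ennreal" where
  "hausdorff_measure s A = (SUP \<delta> \<in> {0<..}. hausdorff_pre s \<delta> A)"


section \<open>Normals and tangent spaces\<close>

text \<open>\<open>n\<close> is the inward unit normal to \<open>S\<close> at the boundary point \<open>x\<close> if \<open>S\<close> agrees near \<open>x\<close> to
  first order with the half-space \<open>{y. (y - x) \<bullet> n > 0}\<close>. For a set which is locally the
  epigraph of a Lipschitz function this holds for some \<open>n\<close> exactly where that function is
  differentiable.\<close>

definition is_inward_normal :: "'a::euclidean_space set \<Rightarrow> 'a \<Rightarrow> 'a \<Rightarrow> bool" where
  "is_inward_normal S x n \<longleftrightarrow> x \<in> frontier S \<and> norm n = 1 \<and>
     (\<forall>\<epsilon>>0. \<exists>\<delta>>0. \<forall>y. norm (y - x) < \<delta> \<longrightarrow>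
        ((y - x) \<bullet> n > \<epsilon> * norm (y - x) \<longrightarrow> y \<in> S) \<and>
        ((y - x) \<bullet> n < - \<epsilon> * norm (y - x) \<longrightarrow> y \<notin> S))"

definition inward_normal :: "'a::euclidean_space set \<Rightarrow> 'a \<Rightarrow> 'a" where
  "inward_normal S x = (THE n. is_inward_normal S x n)"

definition outward_normal :: "'a::euclidean_space set \<Rightarrow> 'a \<Rightarrow> 'a" where
  "outward_normal S x = - inward_normal S x"

definition tangent_space :: "'a::euclidean_space set \<Rightarrow> 'a \<Rightarrow> 'a set" where
  "tangent_space C c = {v. v \<bullet> outward_normal C c = 0}"


section \<open>Convex core and the class of domains\<close>

definition convex_core :: "'a::euclidean_space set \<Rightarrow> bool" where
  "convex_core C \<longleftrightarrow> compact C \<and> convex C \<and> interior C \<noteq> {} \<and> C2_hypersurface (frontier C)"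

definition class_O :: "'a::euclidean_space set \<Rightarrow> 'a set set" where
  "class_O C = {\<Omega>. open \<Omega> \<and>
     interior C \<subseteq> \<Omega> \<and>
     lipschitz_boundary_outside C \<Omega> \<and>
     (\<forall>c\<in>frontier C. connected ({c + t *\<^sub>R outward_normal C c | t. t \<ge> 0} \<inter> \<Omega>)) \<and>
     hausdorff_measure (DIM('a) - 1)
       {x \<in> frontier \<Omega>. \<exists>n. is_inward_normal \<Omega> x n \<and> {x + t *\<^sub>R n | t. t \<ge> 0} \<inter> C = {}} = 0}"

definition thickness_set :: "'a::euclidean_space set \<Rightarrow> 'a set \<Rightarrow> 'a \<Rightarrow> real set" where
  "thickness_set C \<Omega> c = {r. r \<ge> 0 \<and> c + r *\<^sub>R outward_normal C c \<in> \<Omega>}"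

text \<open>The supremum is taken in \<open>[0, \<infinity>)\<close>, so that the supremum of the empty set is \<open>0\<close>.\<close>

definition thickness :: "'a::euclidean_space set \<Rightarrow> 'a set \<Rightarrow> 'a \<Rightarrow> real" where
  "thickness C \<Omega> c = Sup (insert 0 (thickness_set C \<Omega> c))"

text \<open>The thickness function is a real-valued (finite) function of class C2.\<close>

definition C2_thickness :: "'a::euclidean_space set \<Rightarrow> 'a set \<Rightarrow> bool" where
  "C2_thickness C \<Omega> \<longleftrightarrow>
     (\<forall>c\<in>frontier C. bdd_above (thickness_set C \<Omega> c)) \<and>
     C2_on_hypersurface (frontier C) (thickness C \<Omega>)"

definition radial_map :: "'a::euclidean_space set \<Rightarrow> 'a set \<Rightarrow> 'a \<Rightarrow> 'a" where
  "radial_map C \<Omega> c = c + thickness C \<Omega> c *\<^sub>R outward_normal C c"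

definition hitting_time :: "'a::euclidean_space set \<Rightarrow> 'a set \<Rightarrow> 'a \<Rightarrow> real" where
  "hitting_time C \<Omega> x = (LEAST t. t \<ge> 0 \<and> x + t *\<^sub>R inward_normal \<Omega> x \<in> C)"

text \<open>At points of \<open>C\<close> the hitting time is \<open>0\<close>, so there the formula gives the identity, whether
  or not \<open>\<Omega>\<close> has a normal. This is how \<open>return_map\<close> is read where the thickness vanishes.\<close>

definition reciprocal_map :: "'a::euclidean_space set \<Rightarrow> 'a set \<Rightarrow> 'a \<Rightarrow> 'a" where
  "reciprocal_map C \<Omega> x = x + hitting_time C \<Omega> x *\<^sub>R inward_normal \<Omega> x"

text \<open>Restricted to \<open>frontier C\<close>, so that equality of return maps is equality as maps on
  \<open>frontier C\<close>.\<close>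

definition return_map :: "'a::euclidean_space set \<Rightarrow> 'a set \<Rightarrow> 'a \<Rightarrow> 'a" where
  "return_map C \<Omega> = restrict (reciprocal_map C \<Omega> \<circ> radial_map C \<Omega>) (frontier C)"


section \<open>Critical points, stability types, basins\<close>

definition riemannian_gradient :: "'a::euclidean_space set \<Rightarrow> ('a \<Rightarrow> real) \<Rightarrow> 'a \<Rightarrow> 'a" where
  "riemannian_gradient C f c =
     (THE g. g \<in> tangent_space C c \<and> (f has_derivative (\<lambda>h. g \<bullet> h)) (at c within frontier C))"

definition critical_points :: "'a::euclidean_space set \<Rightarrow> ('a \<Rightarrow> real) \<Rightarrow> 'a set" where
  "critical_points C f = {c \<in> frontier C. riemannian_gradient C f c = 0}"

definition fixed_points :: "'a::euclidean_space set \<Rightarrow> ('a \<Rightarrow> 'a) \<Rightarrow> 'a set" where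
  "fixed_points C F = {c \<in> frontier C. F c = c}"

text \<open>The spectrum of the differential of \<open>F\<close> at \<open>c\<close> as an operator on the tangent space: \<open>\<mu>\<close> is an
  eigenvalue with eigenvector \<open>u + \<i> v\<close> in the complexification. Derivatives within
  \<open>frontier C\<close> are only determined on tangent vectors, and only these enter.\<close>

definition differential_spectrum :: "'a::euclidean_space set \<Rightarrow> ('a \<Rightarrow> 'a) \<Rightarrow> 'a \<Rightarrow> complex set" where
  "differential_spectrum C F c =
     (let DF = frechet_derivative F (at c within frontier C) in
      {\<mu>. \<exists>u\<in>tangent_space C c. \<exists>v\<in>tangent_space C c. (u \<noteq> 0 \<or> v \<noteq> 0) \<and>
            DF u = Re \<mu> *\<^sub>R u - Im \<mu> *\<^sub>R v \<and> DF v = Re \<mu> *\<^sub>R v + Im \<mu> *\<^sub>R u})"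

datatype behaviour = Contraction | Expansion | Marginal

definition eigenvalue_behaviour :: "complex \<Rightarrow> behaviour" where
  "eigenvalue_behaviour \<mu> =
     (if cmod \<mu> < 1 then Contraction else if cmod \<mu> > 1 then Expansion else Marginal)"

text \<open>The behaviours which occur, so that for instance \<open>{Contraction}\<close> is a sink and
  \<open>{Contraction, Expansion}\<close> a hyperbolic saddle.\<close>

definition stability_type :: "'a::euclidean_space set \<Rightarrow> ('a \<Rightarrow> 'a) \<Rightarrow> 'a \<Rightarrow> behaviour set" where
  "stability_type C F c = eigenvalue_behaviour ` differential_spectrum C F c"

definition basin :: "'a::euclidean_space set \<Rightarrow> ('a \<Rightarrow> 'a) \<Rightarrow> 'a \<Rightarrow> 'a set" where
  "basin C F p = {c \<in> frontier C. (\<lambda>n. (F ^^ n) c) \<longlonglongrightarrow> p}"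

text \<open>The decomposition consists of the basins of the critical points of \<open>f\<close>, together with the
  set of points lying in no such basin if there are any (for instance periodic points).\<close>

definition basin_decomposition ::
    "'a::euclidean_space set \<Rightarrow> ('a \<Rightarrow> real) \<Rightarrow> ('a \<Rightarrow> 'a) \<Rightarrow> 'a set set" where
  "basin_decomposition C f F =
     (let B = basin C F ` critical_points C f in B \<union> ({frontier C - \<Union>B} - {{}}))"

text \<open>\<open>X\<close> depends on the domain only through its return map: any other admissible
  domain with the same return map as \<open>\<Omega>\<close> gives the same value of \<open>X\<close>.\<close>

definition return_map_determines ::
    "'a::euclidean_space set \<Rightarrow> 'a set \<Rightarrow> ('a set \<Rightarrow> 'b) \<Rightarrow> bool" where
  "return_map_determines C \<Omega> X \<longleftrightarrow>
     (\<forall>\<Omega>'. \<Omega>' \<in> class_O C \<and> C2_thickness C \<Omega>' \<and> return_map C \<Omega>' = return_map C \<Omega> \<longrightarrow>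
        X \<Omega>' = X \<Omega>)"

end

theory Submission
  imports Defs
begin

text \<open>Where the thickness \<open>d\<close> is positive, \<open>\<Omega>\<close> is the region below the graph of \<open>d\<close> in the normal
  coordinates \<open>c + t \<nu>(c)\<close>, because \<open>\<Omega>\<close> is open and meets the normal rays in connected sets. Hence
  the inward normal of \<open>\<Omega>\<close> at \<open>\<Phi>(c)\<close> is the normalisation of \<open>w - \<nu>(c)\<close>, where the tangent vector
  \<open>w\<close> solves \<open>(I + d D\<nu>)\<^sup>T w = \<nabla>d(c)\<close>. By convexity \<open>D\<nu>\<close> is positive semidefinite, so \<open>w\<close> exists,
  \<open>|w| \<le> |\<nabla>d|\<close>, and \<open>w = 0\<close> exactly at critical points; the ray from \<open>\<Phi>(c)\<close> returns to \<open>c\<close> iff \<open>w = 0\<close>.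
  Points with \<open>d = 0\<close> are minima of \<open>d\<close> and are fixed by convention.

  The coefficient \<open>D\<nu>\<close> is only continuous, but as \<open>w\<close> vanishes at a critical point this suffices for
  \<open>w\<close> to be differentiable there, and the ray hits the frontier of \<open>C\<close> transversally. Where \<open>d = 0\<close>,
  the ray hits \<open>C\<close> within time \<open>3 d\<close>, so that \<open>F\<close> differs from the identity by \<open>O(d)\<close>.\<close>

section \<open>Inward normals\<close>

text \<open>Once the fixed points are known to be the critical points, the determination claims are
  formal, as every object is built from \<open>F\<close> and the critical set. The analytic work
  also includes differentiability of \<open>F\<close> at its fixed points: otherwise
  \<open>frechet_derivative\<close> would be an arbitrary choice and the spectrum meaningless. No
  charts are used. Outside \<open>C\<close> the nearest-point projection supplies global normal
  coordinates: its fibres over the frontier are the normal rays, and it never has to be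
  differentiated because it is 1-Lipschitz. On the frontier, derivatives are tested along secants
  converging to a tangent vector, and a local extension of \<open>\<nu>\<close> of class C1 makes
  ambient calculus available.\<close>

lemma is_inward_normalD:
  assumes "is_inward_normal S x n" "\<epsilon> > 0"
  obtains \<delta> where "\<delta> > 0"
    "\<And>y. \<lbrakk>norm (y - x) < \<delta>; (y - x) \<bullet> n > \<epsilon> * norm (y - x)\<rbrakk> \<Longrightarrow> y \<in> S"
    "\<And>y. \<lbrakk>norm (y - x) < \<delta>; (y - x) \<bullet> n < - \<epsilon> * norm (y - x)\<rbrakk> \<Longrightarrow> y \<notin> S"
  using assms unfolding is_inward_normal_def by metis

text \<open>A short step along \<open>n - m\<close> would lie in the inner cone of \<open>n\<close>
  and in the outer cone of \<open>m\<close>, hence both in \<open>S\<close> and outside it.\<close>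

lemma is_inward_normal_unique:
  assumes n: "is_inward_normal S x n" and m: "is_inward_normal S x m"
  shows "n = m"
proof (rule ccontr)
  assume "n \<noteq> m"
  define q where "q = n - m"
  have q0: "norm q > 0" using \<open>n \<noteq> m\<close> by (simp add: q_def)
  have nn: "n \<bullet> n = 1" "m \<bullet> m = 1"
    using n m by (auto simp: is_inward_normal_def dot_square_norm)
  have qq: "(norm q)\<^sup>2 = 2 - 2 * (n \<bullet> m)"
    by (simp add: q_def power2_norm_eq_inner inner_diff inner_commute nn)
  have qn: "q \<bullet> n = (norm q)\<^sup>2 / 2" and qm: "q \<bullet> m = - (norm q)\<^sup>2 / 2"
    unfolding qq by (simp_all add: q_def inner_diff nn inner_commute)
  \<comment> \<open>The angles between \<open>q\<close> and \<open>n\<close> and between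
    \<open>- q\<close> and \<open>m\<close> both have cosine \<open>norm q / 2\<close>; any smaller
    aperture would do.\<close>
  have e: "norm q / 4 > 0" using q0 by simp
  obtain \<delta>1 where 1: "\<delta>1 > 0"
    "\<And>y. \<lbrakk>norm (y - x) < \<delta>1; (y - x) \<bullet> n > norm q / 4 * norm (y - x)\<rbrakk> \<Longrightarrow> y \<in> S"
    using is_inward_normalD[OF n e] by metis
  obtain \<delta>2 where 2: "\<delta>2 > 0"
    "\<And>y. \<lbrakk>norm (y - x) < \<delta>2; (y - x) \<bullet> m < - (norm q / 4) * norm (y - x)\<rbrakk> \<Longrightarrow> y \<notin> S"
    using is_inward_normalD[OF m e] by metis
  define s where "s = min \<delta>1 \<delta>2 / (2 * norm q)"
  have s: "s > 0" using 1(1) 2(1) q0 by (simp add: s_def)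
  have sq: "s * norm q = min \<delta>1 \<delta>2 / 2" using q0 by (simp add: s_def)
  have pos: "norm q * norm q > 0" using q0 by (intro mult_pos_pos)
  have "x + s *\<^sub>R q \<in> S"
    by (rule 1(2)) (use s sq 1(1) 2(1) pos in \<open>simp_all add: qn power2_eq_square\<close>)
  moreover have "x + s *\<^sub>R q \<notin> S"
    by (rule 2(2)) (use s sq 1(1) 2(1) pos in \<open>simp_all add: qm power2_eq_square\<close>)
  ultimately show False by simp
qed

lemma inward_normal_eqI: "is_inward_normal S x n \<Longrightarrow> inward_normal S x = n"
  unfolding inward_normal_def by (blast intro: is_inward_normal_unique)

text \<open>Off a thin double cone around the tangent hyperplane, the linear term of
  \<open>G\<close> dominates the remainder and decides the sign. Differentiability at the single
  point \<open>x\<close> suffices, which allows \<open>G\<close> to involve the nearest-point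
  projection.\<close>

lemma is_inward_normal_of_derivative:
  fixes G :: "'a::euclidean_space \<Rightarrow> real"
  assumes dG: "(G has_derivative (\<lambda>h. g \<bullet> h)) (at x)" and g: "g \<noteq> 0"
    and Gx: "G x = 0" and ev: "eventually (\<lambda>y. y \<in> S \<longleftrightarrow> G y > 0) (nhds x)"
  shows "is_inward_normal S x (g /\<^sub>R norm g)"
proof -
  define n where "n = g /\<^sub>R norm g"
  have gn: "g = norm g *\<^sub>R n" using g by (simp add: n_def)
  have n1: "norm n = 1" using g by (simp add: n_def)
  have ng: "norm g > 0" using g by simp
  have main: "\<exists>\<delta>>0. \<forall>y. norm (y - x) < \<delta> \<longrightarrow>
        ((y - x) \<bullet> n > \<epsilon> * norm (y - x) \<longrightarrow> y \<in> S) \<and>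
        ((y - x) \<bullet> n < - \<epsilon> * norm (y - x) \<longrightarrow> y \<notin> S)" if "\<epsilon> > 0" for \<epsilon>
  proof -
    have "norm g * \<epsilon> > 0" using ng that by simp
    then obtain d1 where d1: "d1 > 0"
      "\<And>y. norm (y - x) < d1 \<Longrightarrow> norm (G y - G x - g \<bullet> (y - x)) \<le> norm g * \<epsilon> * norm (y - x)"
      using dG unfolding has_derivative_at_alt by blast
    obtain d2 where d2: "d2 > 0" "\<And>y. norm (y - x) < d2 \<Longrightarrow> y \<in> S \<longleftrightarrow> G y > 0"
      using ev unfolding eventually_nhds_metric dist_norm by blast
    show ?thesis
    proof (intro exI[of _ "min d1 d2"] conjI allI impI)
      show "min d1 d2 > 0" using d1 d2 by simp
    next
      fix y assume y: "norm (y - x) < min d1 d2" and "(y - x) \<bullet> n > \<epsilon> * norm (y - x)"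
      then have "norm g * ((y - x) \<bullet> n) > norm g * (\<epsilon> * norm (y - x))" using ng by simp
      then have "g \<bullet> (y - x) > norm g * \<epsilon> * norm (y - x)"
        by (subst gn) (simp add: inner_commute algebra_simps)
      then show "y \<in> S" using d1(2)[of y] d2(2)[of y] y Gx by auto
    next
      fix y assume y: "norm (y - x) < min d1 d2" and "(y - x) \<bullet> n < - \<epsilon> * norm (y - x)"
      then have "norm g * ((y - x) \<bullet> n) < norm g * (- \<epsilon> * norm (y - x))" using ng
        by (simp only: mult_less_cancel_left_pos)
      then have "g \<bullet> (y - x) < - (norm g * \<epsilon> * norm (y - x))"
        by (subst gn) (simp add: inner_commute algebra_simps)
      then show "y \<notin> S" using d1(2)[of y] d2(2)[of y] y Gx by auto
    qed
  qed
  have "x \<in> frontier S"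
    unfolding frontier_straddle
  proof (intro CollectI allI impI)
    fix e :: real assume e: "0 < e"
    obtain d where d: "d > 0" "\<And>y. norm (y - x) < d \<Longrightarrow>
        ((y - x) \<bullet> n > 1/2 * norm (y - x) \<longrightarrow> y \<in> S) \<and>
        ((y - x) \<bullet> n < - (1/2) * norm (y - x) \<longrightarrow> y \<notin> S)"
      using main[of "1/2"] by auto
    define s where "s = min d e / 2"
    have s: "s > 0" "s < d" "s < e" using d e by (auto simp: s_def)
    have nn: "n \<bullet> n = 1" using n1 by (simp add: dot_square_norm)
    have "x + s *\<^sub>R n \<in> S" "x - s *\<^sub>R n \<notin> S"
      using d(2)[of "x + s *\<^sub>R n"] d(2)[of "x - s *\<^sub>R n"] s n1 nn by auto
    then show "(\<exists>y\<in>S. dist x y < e) \<and> (\<exists>y. y \<notin> S \<and> dist x y < e)"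
      using s n1 by (intro conjI bexI[of _ "x + s *\<^sub>R n"] exI[of _ "x - s *\<^sub>R n"]) (auto simp: dist_norm)
  qed
  then show ?thesis using main n1 unfolding is_inward_normal_def n_def by blast
qed

section \<open>Convex sets near regular boundary points\<close>

text \<open>The cone is a strict sublevel set of the convex function
  \<open>\<epsilon> * norm (y - c) - (y - c) \<bullet> n\<close>. Convexity is wanted for the
  connectedness of the truncated cone.\<close>

lemma convex_cone_ball:
  fixes c n :: "'a::euclidean_space"
  assumes "\<epsilon> > 0"
  shows "convex (ball c \<delta> \<inter> {y. (y - c) \<bullet> n > \<epsilon> * norm (y - c)})"
proof (rule convex_Int)
  show "convex {y. (y - c) \<bullet> n > \<epsilon> * norm (y - c)}"
  proof (rule convexI, clarsimp)
    fix x y and u v :: real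
    assume x: "\<epsilon> * norm (x - c) < (x - c) \<bullet> n" and y: "\<epsilon> * norm (y - c) < (y - c) \<bullet> n"
      and uv: "0 \<le> u" "0 \<le> v" "u + v = 1"
    have c: "u *\<^sub>R x + v *\<^sub>R y - c = u *\<^sub>R (x - c) + v *\<^sub>R (y - c)"
      using uv(3) by (simp add: algebra_simps flip: scaleR_add_left)
    have "norm (u *\<^sub>R (x - c) + v *\<^sub>R (y - c)) \<le> u * norm (x - c) + v * norm (y - c)"
      using uv by (metis abs_of_nonneg norm_scaleR norm_triangle_ineq)
    then have "\<epsilon> * norm (u *\<^sub>R (x - c) + v *\<^sub>R (y - c)) \<le> \<epsilon> * (u * norm (x - c) + v * norm (y - c))"
      using assms by simp
    also have "\<dots> = u * (\<epsilon> * norm (x - c)) + v * (\<epsilon> * norm (y - c))" by (simp add: algebra_simps)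
    also have "\<dots> < u * ((x - c) \<bullet> n) + v * ((y - c) \<bullet> n)"
    proof (cases "u = 0")
      case True then show ?thesis using uv y by simp
    next
      case False
      then have "u * (\<epsilon> * norm (x - c)) < u * ((x - c) \<bullet> n)" using uv x by simp
      moreover have "v * (\<epsilon> * norm (y - c)) \<le> v * ((y - c) \<bullet> n)" using uv y by (simp add: mult_left_mono)
      ultimately show ?thesis by linarith
    qed
    finally show "\<epsilon> * norm (u *\<^sub>R x + v *\<^sub>R y - c) < (u *\<^sub>R x + v *\<^sub>R y - c) \<bullet> n"
      unfolding c by (simp add: inner_add_left)
  qed
qed simp

text \<open>A convex set with nonempty interior lies on one side of a level set through its boundary
  point: the two small cones around the gradient direction avoid the frontier, so each of them is
  contained in the interior or misses the set.\<close>

lemma convex_level_set_normal: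
  fixes C :: "'a::euclidean_space set"
  assumes cv: "convex C" and cl: "closed C" and int: "interior C \<noteq> {}" and c: "c \<in> frontier C"
    and U: "open U" "c \<in> U" and d\<rho>: "GDERIV \<rho> c :> g" and g: "g \<noteq> 0"
    and level: "frontier C \<inter> U = {x \<in> U. \<rho> x = 0}"
  shows "\<exists>\<sigma>. \<bar>\<sigma>\<bar> = 1 \<and> is_inward_normal C c (\<sigma> *\<^sub>R (g /\<^sub>R norm g))"
proof -
  have cC: "c \<in> C" "c \<notin> interior C" using c cl by (auto simp: frontier_def)
  have \<rho>c: "\<rho> c = 0" using level c U by blast
  define n0 where "n0 = g /\<^sub>R norm g"
  have n0: "norm n0 = 1" and gn: "g = norm g *\<^sub>R n0" and ng: "norm g > 0"
    using g by (auto simp: n0_def)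
  have nn0: "n0 \<bullet> n0 = 1" using n0 by (simp add: dot_square_norm)
  \<comment> \<open>An interior point off the tangent hyperplane decides which of \<open>n0\<close>
    and \<open>- n0\<close> points inwards; a point on the hyperplane is shifted along
    \<open>n0\<close>.\<close>
  obtain z where z: "z \<in> interior C" "(z - c) \<bullet> n0 \<noteq> 0"
  proof -
    obtain z0 where z0: "z0 \<in> interior C" using int by blast
    obtain r where r: "r > 0" "ball z0 r \<subseteq> interior C" using z0 open_contains_ball open_interior by metis
    show ?thesis
    proof (cases "(z0 - c) \<bullet> n0 = 0")
      case True
      have "z0 + (r/2) *\<^sub>R n0 \<in> interior C" using r n0 by (auto simp: dist_norm)
      moreover have "(z0 + (r/2) *\<^sub>R n0 - c) \<bullet> n0 \<noteq> 0" using True r nn0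
        by (simp add: inner_diff_left inner_add_left)
      ultimately show ?thesis using that by blast
    qed (use that z0 in blast)
  qed
  define \<sigma> where "\<sigma> = sgn ((z - c) \<bullet> n0)"
  have \<sigma>: "\<bar>\<sigma>\<bar> = 1" using z by (simp add: \<sigma>_def abs_sgn_eq)
  define n where "n = \<sigma> *\<^sub>R n0"
  have n: "norm n = 1" using \<sigma> n0 by (simp add: n_def)
  have nn: "n \<bullet> n = 1" using n by (simp add: dot_square_norm)
  have zn: "(z - c) \<bullet> n > 0" using z by (simp add: n_def \<sigma>_def sgn_if)
  have zc: "norm (z - c) > 0" using zn by auto
  \<comment> \<open>The second bound puts \<open>z\<close> into the cone around \<open>n\<close>,
    the first one keeps the axis of the cone inside it.\<close>
  define \<epsilon>0 where "\<epsilon>0 = min (1/2) ((z - c) \<bullet> n / (2 * norm (z - c)))"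
  have \<epsilon>0: "\<epsilon>0 > 0" "\<epsilon>0 \<le> 1/2" using zn zc by (auto simp: \<epsilon>0_def)
  have "\<epsilon>0 * norm (z - c) \<le> (z - c) \<bullet> n / (2 * norm (z - c)) * norm (z - c)"
    unfolding \<epsilon>0_def by (intro mult_right_mono) auto
  then have z\<epsilon>: "\<epsilon>0 * norm (z - c) < (z - c) \<bullet> n" using zn zc by simp
  have small: "\<exists>\<delta>>0. (\<forall>y. norm (y - c) < \<delta> \<longrightarrow> (y - c) \<bullet> n > \<epsilon> * norm (y - c) \<longrightarrow> y \<in> interior C) \<and>
      (\<forall>y. norm (y - c) < \<delta> \<longrightarrow> (y - c) \<bullet> n < - \<epsilon> * norm (y - c) \<longrightarrow> y \<notin> C)"
    if \<epsilon>: "0 < \<epsilon>" "\<epsilon> \<le> \<epsilon>0" for \<epsilon>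
  proof -
    have "norm g * \<epsilon> > 0" using ng \<epsilon> by simp
    then obtain d1 where d1: "d1 > 0"
      "\<And>y. norm (y - c) < d1 \<Longrightarrow> norm (\<rho> y - \<rho> c - (y - c) \<bullet> g) \<le> norm g * \<epsilon> * norm (y - c)"
      using d\<rho> unfolding gderiv_def has_derivative_at_alt by blast
    obtain d2 where d2: "d2 > 0" "ball c d2 \<subseteq> U" using U open_contains_ball by metis
    define \<delta> where "\<delta> = min d1 d2"
    have \<delta>: "\<delta> > 0" using d1 d2 by (simp add: \<delta>_def)
    define K where "K m = ball c \<delta> \<inter> {y. (y - c) \<bullet> m > \<epsilon> * norm (y - c)}" for m
    have avoid: "K m \<inter> frontier C = {}" if "m = n0 \<or> m = - n0" for m
    proof (rule ccontr)
      assume "K m \<inter> frontier C \<noteq> {}"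
      then obtain y where y: "y \<in> K m" "y \<in> frontier C" by blast
      have yU: "y \<in> U" "norm (y - c) < d1" using y d2 by (auto simp: K_def \<delta>_def dist_norm norm_minus_commute)
      then have "\<rho> y = 0" using level y by blast
      then have "\<bar>(y - c) \<bullet> g\<bar> \<le> norm g * \<epsilon> * norm (y - c)" using d1(2)[OF yU(2)] \<rho>c by simp
      then have "\<bar>(y - c) \<bullet> m\<bar> \<le> \<epsilon> * norm (y - c)"
        using that ng by (subst (asm) gn) (auto simp: abs_mult mult.assoc)
      then show False using y by (auto simp: K_def)
    qed
    have mm: "n = n0 \<or> n = - n0" "- n = n0 \<or> - n = - n0" using \<sigma> by (auto simp: n_def abs_if split: if_splits)
    have conn: "connected (K m)" for m
      unfolding K_def using \<epsilon> by (intro convex_connected convex_cone_ball) simp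
    have dich: "K m \<subseteq> interior C \<or> K m \<inter> C = {}" if "m = n0 \<or> m = - n0" for m
    proof (rule ccontr)
      assume "\<not> ?thesis"
      then have "K m \<inter> C \<noteq> {}" "\<not> K m \<subseteq> interior C" by auto
      moreover then have "K m - C \<noteq> {}" using avoid[OF that] cl by (auto simp: frontier_def)
      ultimately show False using connected_Int_frontier[OF conn, of m C] avoid[OF that] by blast
    qed
    \<comment> \<open>A point of the segment from \<open>c\<close> to \<open>z\<close> close to
      \<open>c\<close> is both interior to \<open>C\<close> and in \<open>K n\<close>, which settles
      the dichotomy for \<open>n\<close>.\<close>
    define s where "s = min 1 (\<delta> / (2 * norm (z - c)))"
    have s: "0 < s" "s \<le> 1" using \<delta> zc by (auto simp: s_def)
    have "s * norm (z - c) \<le> \<delta> / (2 * norm (z - c)) * norm (z - c)"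
      unfolding s_def by (intro mult_right_mono) auto
    then have s': "s * norm (z - c) < \<delta>" using \<delta> zc by simp
    have zs: "c + s *\<^sub>R (z - c) \<in> K n"
    proof -
      have "\<epsilon> * norm (z - c) \<le> \<epsilon>0 * norm (z - c)" using \<epsilon> by (intro mult_right_mono) auto
      then have "\<epsilon> * norm (z - c) < (z - c) \<bullet> n" using z\<epsilon> by linarith
      then have "s * (\<epsilon> * norm (z - c)) < s * ((z - c) \<bullet> n)" using s by simp
      moreover have "dist c (c + s *\<^sub>R (z - c)) = s * norm (z - c)"
        using s by (simp add: dist_norm)
      ultimately show ?thesis using s s' by (simp add: K_def mult.left_commute)
    qed
    moreover have "c + s *\<^sub>R (z - c) \<in> interior C"
      using mem_interior_convex_shrink[OF cv z(1) cC(1) s] by (simp add: algebra_simps)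
    ultimately have Kn: "K n \<subseteq> interior C" using dich[OF mm(1)] interior_subset by blast
    have in_K: "c + (\<delta>/2) *\<^sub>R m \<in> K m" if "norm m = 1" for m
      using that \<delta> \<epsilon> \<epsilon>0 by (simp add: K_def dist_norm dot_square_norm)
    \<comment> \<open>Otherwise \<open>c\<close> would be the midpoint of two interior
      points.\<close>
    have "\<not> K (- n) \<subseteq> interior C"
    proof
      assume *: "K (- n) \<subseteq> interior C"
      have "c + (\<delta>/2) *\<^sub>R n \<in> interior C" "c + (\<delta>/2) *\<^sub>R (- n) \<in> interior C"
        using * Kn in_K[of n] in_K[of "- n"] n by auto
      then have "(1/2) *\<^sub>R (c + (\<delta>/2) *\<^sub>R n) + (1/2) *\<^sub>R (c + (\<delta>/2) *\<^sub>R (- n)) \<in> interior C"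
        using cv by (intro convexD[of "interior C"]) auto
      moreover have "(1/2) *\<^sub>R (c + (\<delta>/2) *\<^sub>R n) + (1/2) *\<^sub>R (c + (\<delta>/2) *\<^sub>R (- n)) = c"
        by (simp add: algebra_simps flip: scaleR_add_left)
      ultimately show False using cC by simp
    qed
    then have Kmn: "K (- n) \<inter> C = {}" using dich[OF mm(2)] by blast
    have K_I: "y \<in> K m" if "norm (y - c) < \<delta>" "(y - c) \<bullet> m > \<epsilon> * norm (y - c)" for y m
      using that by (auto simp: K_def dist_norm norm_minus_commute)
    show ?thesis
    proof (intro exI[of _ \<delta>] conjI allI impI)
      fix y assume "norm (y - c) < \<delta>" "(y - c) \<bullet> n > \<epsilon> * norm (y - c)"
      then show "y \<in> interior C" using K_I Kn by blast
    next
      fix y assume "norm (y - c) < \<delta>" "(y - c) \<bullet> n < - \<epsilon> * norm (y - c)"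
      then have "y \<in> K (- n)" by (intro K_I) auto
      then show "y \<notin> C" using Kmn by blast
    qed (rule \<delta>)
  qed
  have "is_inward_normal C c n"
    unfolding is_inward_normal_def
  proof (intro conjI allI impI)
    fix \<epsilon> :: real assume "\<epsilon> > 0"
    then obtain \<delta> where \<delta>: "\<delta> > 0" 
      "\<And>y. norm (y - c) < \<delta> \<Longrightarrow> (y - c) \<bullet> n > min \<epsilon> \<epsilon>0 * norm (y - c) \<Longrightarrow> y \<in> interior C"
      "\<And>y. norm (y - c) < \<delta> \<Longrightarrow> (y - c) \<bullet> n < - min \<epsilon> \<epsilon>0 * norm (y - c) \<Longrightarrow> y \<notin> C"
      using small[of "min \<epsilon> \<epsilon>0"] \<epsilon>0 by auto
    have le: "min \<epsilon> \<epsilon>0 * norm (y - c) \<le> \<epsilon> * norm (y - c)" for y by (intro mult_right_mono) auto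
    show "\<exists>\<delta>>0. \<forall>y. norm (y - c) < \<delta> \<longrightarrow>
        ((y - c) \<bullet> n > \<epsilon> * norm (y - c) \<longrightarrow> y \<in> C) \<and>
        ((y - c) \<bullet> n < - \<epsilon> * norm (y - c) \<longrightarrow> y \<notin> C)"
    proof (intro exI[of _ \<delta>] conjI allI impI)
      fix y assume "norm (y - c) < \<delta>" "(y - c) \<bullet> n > \<epsilon> * norm (y - c)"
      then show "y \<in> C" using \<delta>(2)[of y] le[of y] interior_subset by (metis order_le_less_trans subsetD)
    next
      fix y assume "norm (y - c) < \<delta>" "(y - c) \<bullet> n < - \<epsilon> * norm (y - c)"
      then show "y \<notin> C" using \<delta>(3)[of y] le[of y] by auto
    qed (rule \<delta>)
  qed (use c n in auto)
  then show ?thesis using \<sigma> unfolding n_def n0_def by blast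
qed

text \<open>If \<open>y\<close> violated the inequality, the segment from \<open>c\<close> to
  \<open>y\<close> would start inside the outer cone, which misses \<open>C\<close> near
  \<open>c\<close>, although convexity keeps it in \<open>C\<close>.\<close>

lemma convex_inward_normal_supporting:
  fixes C :: "'a::euclidean_space set"
  assumes "convex C" "closed C" and n: "is_inward_normal C c n" and y: "y \<in> C"
  shows "(y - c) \<bullet> n \<ge> 0"
proof (rule ccontr)
  assume neg: "\<not> ?thesis"
  have cC: "c \<in> C" using n assms(2) by (auto simp: is_inward_normal_def frontier_def)
  have yc: "norm (y - c) > 0" using neg by auto
  define \<epsilon> where "\<epsilon> = - ((y - c) \<bullet> n) / (2 * norm (y - c))"
  have \<epsilon>: "\<epsilon> > 0" using neg yc unfolding \<epsilon>_def by (intro divide_pos_pos) auto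
  have ey: "\<epsilon> * norm (y - c) = - ((y - c) \<bullet> n) / 2" using yc by (simp add: \<epsilon>_def)
  obtain \<delta> where \<delta>: "\<delta> > 0"
    "\<And>y. \<lbrakk>norm (y - c) < \<delta>; (y - c) \<bullet> n < - \<epsilon> * norm (y - c)\<rbrakk> \<Longrightarrow> y \<notin> C"
    using is_inward_normalD[OF n \<epsilon>] by metis
  define s where "s = min 1 (\<delta> / (2 * norm (y - c)))"
  have s: "0 < s" "s \<le> 1" using \<delta> yc by (auto simp: s_def)
  have "s * norm (y - c) \<le> \<delta> / (2 * norm (y - c)) * norm (y - c)"
    unfolding s_def by (intro mult_right_mono) auto
  then have s': "s * norm (y - c) < \<delta>" using \<delta> yc by simp
  have "(1 - s) *\<^sub>R c + s *\<^sub>R y \<in> C" using assms(1) cC y s by (intro convexD) auto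
  moreover have "c + s *\<^sub>R (y - c) \<notin> C"
  proof (rule \<delta>(2))
    have "s * ((y - c) \<bullet> n) < s * (- \<epsilon> * norm (y - c))"
      using s neg ey by (intro mult_strict_left_mono) auto
    then show "(c + s *\<^sub>R (y - c) - c) \<bullet> n < - \<epsilon> * norm (c + s *\<^sub>R (y - c) - c)"
      using s by (simp add: mult.left_commute)
  qed (use s s' in simp)
  ultimately show False by (simp add: algebra_simps)
qed

section \<open>Convex cores of class C2\<close>

lemma has_derivative_sgn:
  fixes y :: "'a::real_inner"
  assumes "y \<noteq> 0"
  shows "(sgn has_derivative (\<lambda>h. (h - (sgn y \<bullet> h) *\<^sub>R sgn y) /\<^sub>R norm y)) (at y)"
proof -
  have "((\<lambda>x. inverse (norm x) *\<^sub>R x) has_derivative (\<lambda>h. (h - (sgn y \<bullet> h) *\<^sub>R sgn y) /\<^sub>R norm y)) (at y)"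
    by (rule derivative_eq_intros has_derivative_norm assms refl | simp add: assms)+
       (simp add: sgn_div_norm assms algebra_simps inner_commute divide_simps fun_eq_iff)
  then show ?thesis by (simp add: sgn_div_norm[abs_def])
qed

text \<open>For a unit vector \<open>n\<close>, the orthogonal projection onto its complement. It is
  a bounded linear function so that its continuity in \<open>n\<close> can be stated in operator
  norm.\<close>

definition blinfun_tangent :: "'a::real_inner \<Rightarrow> 'a \<Rightarrow>\<^sub>L 'a" where
  "blinfun_tangent n = id_blinfun - (blinfun_scaleR_left n o\<^sub>L blinfun_inner_right n)"

lemma blinfun_tangent_apply: "blinfun_apply (blinfun_tangent n) v = v - (n \<bullet> v) *\<^sub>R n"
  by (simp add: blinfun_tangent_def blinfun.diff_left)

lemma continuous_on_blinfun_tangent [continuous_intros]: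
  "continuous_on S f \<Longrightarrow> continuous_on S (\<lambda>x. blinfun_tangent (f x))"
  unfolding blinfun_tangent_def
  by (intro continuous_intros bounded_linear.continuous_on[OF bounded_linear_blinfun_scaleR_left]
      bounded_linear.continuous_on[OF bounded_linear_blinfun_inner_right])

locale C2_convex_core =
  fixes C :: "'a::euclidean_space set"
  assumes convex_core: "convex_core C"
begin

abbreviation \<nu> :: "'a \<Rightarrow> 'a" where "\<nu> \<equiv> outward_normal C"

lemma convex: "convex C" and interior_nonempty: "interior C \<noteq> {}"
  and closed: "closed C" and nonempty: "C \<noteq> {}"
  and hypersurface: "C2_hypersurface (frontier C)"
  using convex_core compact_imp_closed by (auto simp: convex_core_def)

lemma frontier_subset: "frontier C \<subseteq> C"
  using closed by (simp add: frontier_def)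

text \<open>The hypersurface condition gives a nonzero gradient only at the base point; continuity
  of \<open>g\<close> preserves it on a smaller neighbourhood. The sign \<sigma> may still vary with
  the point here.\<close>

lemma local_level_set:
  assumes "c \<in> frontier C"
  obtains U g H where "open U" "c \<in> U"
    "\<And>x. x \<in> U \<Longrightarrow> g x \<noteq> 0"
    "\<And>x. x \<in> U \<Longrightarrow> (g has_derivative blinfun_apply (H x)) (at x)"
    "continuous_on U H"
    "\<And>x. x \<in> frontier C \<inter> U \<Longrightarrow> \<exists>\<sigma>. \<bar>\<sigma>\<bar> = 1 \<and> is_inward_normal C x (\<sigma> *\<^sub>R sgn (g x))"
proof -
  obtain U \<rho> where U: "open U" "c \<in> U" and C2: "C2_on U \<rho>" and c0: "\<not> (GDERIV \<rho> c :> 0)"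
    and level: "frontier C \<inter> U = {x \<in> U. \<rho> x = 0}"
    using bspec[OF hypersurface[unfolded C2_hypersurface_def] assms] by metis
  obtain g and H :: "'a \<Rightarrow> 'a \<Rightarrow>\<^sub>L 'a" where g: "\<And>x. x \<in> U \<Longrightarrow> GDERIV \<rho> x :> g x"
    and H: "\<And>x. x \<in> U \<Longrightarrow> (g has_derivative blinfun_apply (H x)) (at x)"
    and cH: "continuous_on U H"
    using C2[unfolded C2_on_def] by metis
  have "continuous_on U g"
    using H by (meson continuous_at_imp_continuous_on has_derivative_continuous)
  moreover have eq: "{x \<in> U. g x \<noteq> 0} = U \<inter> g -` (- {0})" by auto
  ultimately have op: "open {x \<in> U. g x \<noteq> 0}"
    using continuous_open_preimage[OF _ U(1), of g "- {0}"]
    unfolding eq by auto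
  show ?thesis
  proof (rule that[of "{x \<in> U. g x \<noteq> 0}" g H])
    show "c \<in> {x \<in> U. g x \<noteq> 0}" using U c0 g[of c] by auto
    show "continuous_on {x \<in> U. g x \<noteq> 0} H" using cH by (rule continuous_on_subset) auto
  next
    fix x assume "x \<in> frontier C \<inter> {x \<in> U. g x \<noteq> 0}"
    then show "\<exists>\<sigma>. \<bar>\<sigma>\<bar> = 1 \<and> is_inward_normal C x (\<sigma> *\<^sub>R sgn (g x))"
      using convex_level_set_normal[OF convex closed interior_nonempty _ U(1) _ g _ level]
      by (auto simp: sgn_div_norm)
  qed (use op H in auto)
qed

lemma is_inward_normal_core: "c \<in> frontier C \<Longrightarrow> is_inward_normal C c (- \<nu> c)"
proof -
  assume c: "c \<in> frontier C"
  have "\<exists>n. is_inward_normal C c n"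
  proof (rule local_level_set[OF c])
    fix U and g :: "'a \<Rightarrow> 'a"
    assume "c \<in> U"
      "\<And>x. x \<in> frontier C \<inter> U \<Longrightarrow> \<exists>\<sigma>. \<bar>\<sigma>\<bar> = 1 \<and> is_inward_normal C x (\<sigma> *\<^sub>R sgn (g x))"
    from this(2)[of c] this(1) c show ?thesis by auto
  qed
  then show ?thesis by (auto simp: outward_normal_def inward_normal_eqI)
qed

lemma norm_\<nu> [simp]: "c \<in> frontier C \<Longrightarrow> norm (\<nu> c) = 1"
  using is_inward_normal_core[of c] by (simp add: is_inward_normal_def)

lemma \<nu>_dot_\<nu> [simp]: "c \<in> frontier C \<Longrightarrow> \<nu> c \<bullet> \<nu> c = 1"
  by (simp add: dot_square_norm)

lemma supporting:
  assumes "c \<in> frontier C" "y \<in> C"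
  shows "(y - c) \<bullet> \<nu> c \<le> 0"
  using convex_inward_normal_supporting[OF convex closed is_inward_normal_core[OF assms(1)] assms(2)]
  by simp

lemma supporting_interior:
  assumes c: "c \<in> frontier C" and y: "y \<in> interior C"
  shows "(y - c) \<bullet> \<nu> c < 0"
proof -
  obtain r where r: "r > 0" "ball y r \<subseteq> C" using y by (auto simp: mem_interior)
  have "y + (r/2) *\<^sub>R \<nu> c \<in> C" using r c by (intro subsetD[OF r(2)]) (simp add: dist_norm)
  then have "(y + (r/2) *\<^sub>R \<nu> c - c) \<bullet> \<nu> c \<le> 0" by (rule supporting[OF c])
  then show ?thesis using r c by (simp add: inner_diff_left inner_add_left)
qed

lemma inner_half_space:
  assumes c: "c \<in> frontier C" and \<epsilon>: "\<epsilon> > 0"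
  obtains \<delta> where "\<delta> > 0"
    "\<And>y. \<lbrakk>norm (y - c) < \<delta>; (y - c) \<bullet> \<nu> c < - \<epsilon> * norm (y - c)\<rbrakk> \<Longrightarrow> y \<in> interior C"
proof -
  obtain \<delta> where \<delta>: "\<delta> > 0"
    "\<And>y. \<lbrakk>norm (y - c) < \<delta>; (y - c) \<bullet> (- \<nu> c) > \<epsilon> * norm (y - c)\<rbrakk> \<Longrightarrow> y \<in> C"
    using is_inward_normalD[OF is_inward_normal_core[OF c] \<epsilon>] by metis
  let ?K = "{y. norm (y - c) < \<delta>} \<inter> {y. (y - c) \<bullet> \<nu> c < - \<epsilon> * norm (y - c)}"
  have "open ?K"
    by (intro open_Int open_Collect_less continuous_intros)
  moreover have "?K \<subseteq> C"
    using \<delta>(2) by auto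
  ultimately have "?K \<subseteq> interior C" by (rule interior_maximal[rotated])
  then show ?thesis by (intro that[OF \<delta>(1)]) auto
qed

lemma inner_cone:
  assumes c: "c \<in> frontier C" and v: "v \<bullet> \<nu> c < 0"
  obtains \<delta> where "\<delta> > 0" "\<And>s. \<lbrakk>0 < s; s < \<delta>\<rbrakk> \<Longrightarrow> c + s *\<^sub>R v \<in> interior C"
proof -
  have v0: "norm v > 0" using v by auto
  define \<epsilon> where "\<epsilon> = - (v \<bullet> \<nu> c) / (2 * norm v)"
  have \<epsilon>: "\<epsilon> > 0" unfolding \<epsilon>_def using v v0 by (intro divide_pos_pos) auto
  have \<epsilon>v: "\<epsilon> * norm v = - (v \<bullet> \<nu> c) / 2" using v0 by (simp add: \<epsilon>_def)
  obtain \<delta> where \<delta>: "\<delta> > 0"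
    "\<And>y. \<lbrakk>norm (y - c) < \<delta>; (y - c) \<bullet> \<nu> c < - \<epsilon> * norm (y - c)\<rbrakk> \<Longrightarrow> y \<in> interior C"
    using inner_half_space[OF c \<epsilon>] by metis
  show ?thesis
  proof (rule that[of "\<delta> / norm v"])
    fix s assume s: "0 < s" "s < \<delta> / norm v"
    have "s * (v \<bullet> \<nu> c) < s * - (\<epsilon> * norm v)" using s v \<epsilon>v by (intro mult_strict_left_mono) auto
    then show "c + s *\<^sub>R v \<in> interior C"
      using s v0 by (intro \<delta>(2)) (auto simp: field_simps)
  qed (use \<delta> v0 in simp)
qed

text \<open>If \<open>m\<close> differed from \<open>\<nu> c\<close>, then
  \<open>m - \<nu> c\<close> would point into \<open>C\<close> while making an acute angle with
  \<open>m\<close>, so a short step along it would violate the support inequality.\<close>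

lemma unique_supporting_normal:
  assumes c: "c \<in> frontier C" and m: "norm m = 1" and supp: "\<And>y. y \<in> C \<Longrightarrow> (y - c) \<bullet> m \<le> 0"
  shows "m = \<nu> c"
proof (rule ccontr)
  assume ne: "m \<noteq> \<nu> c"
  have mm: "m \<bullet> m = 1" using m by (simp add: dot_square_norm)
  have "0 < (m - \<nu> c) \<bullet> (m - \<nu> c)" using ne by simp
  then have lt: "m \<bullet> \<nu> c < 1" using mm c by (simp add: inner_diff inner_commute)
  then have "(m - \<nu> c) \<bullet> \<nu> c < 0" using c by (simp add: inner_diff_left)
  then obtain \<delta> where \<delta>: "\<delta> > 0" "\<And>s. \<lbrakk>0 < s; s < \<delta>\<rbrakk> \<Longrightarrow> c + s *\<^sub>R (m - \<nu> c) \<in> C"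
    using inner_cone[OF c] interior_subset by (metis subsetD)
  have "(c + (\<delta>/2) *\<^sub>R (m - \<nu> c) - c) \<bullet> m \<le> 0" by (intro supp \<delta>) (use \<delta> in auto)
  then have "(\<delta>/2) * (1 - m \<bullet> \<nu> c) \<le> 0" by (simp add: inner_diff_right mm inner_commute)
  then show False using \<delta>(1) lt by (simp add: mult_le_0_iff)
qed

section \<open>Nearest points and normal rays\<close>

text \<open>The obtuse-angle property of the nearest point makes \<open>y - p\<close> a supporting
  normal at \<open>p\<close>, and that normal is unique. This provides normal coordinates on the
  whole complement of \<open>C\<close>.\<close>

lemma closest_point_outside:
  assumes y: "y \<notin> C"
  shows "closest_point C y \<in> frontier C"
    and "y = closest_point C y + dist y (closest_point C y) *\<^sub>R \<nu> (closest_point C y)"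
proof -
  define p where "p = closest_point C y"
  have pC: "p \<in> C" using closed nonempty by (simp add: p_def closest_point_in_set)
  have yp: "norm (y - p) > 0" using y pC by auto
  have dot: "(y - p) \<bullet> (x - p) \<le> 0" if "x \<in> C" for x
    unfolding p_def using closest_point_dot[OF convex closed that] .
  have "p \<notin> interior C"
  proof
    assume "p \<in> interior C"
    then obtain r where r: "r > 0" "ball p r \<subseteq> C" by (auto simp: mem_interior)
    have "p + (r / (2 * norm (y - p))) *\<^sub>R (y - p) \<in> C"
      using r yp by (intro subsetD[OF r(2)]) (simp add: dist_norm)
    from dot[OF this] have "(r / (2 * norm (y - p))) * (norm (y - p))\<^sup>2 \<le> 0"
      by (simp add: dot_square_norm)
    then show False using r yp by (simp add: mult_le_0_iff divide_le_0_iff)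
  qed
  then show fr: "closest_point C y \<in> frontier C"
    using pC closed by (simp add: frontier_def p_def)
  have "sgn (y - p) = \<nu> p"
  proof (rule unique_supporting_normal)
    fix x assume "x \<in> C"
    then show "(x - p) \<bullet> sgn (y - p) \<le> 0"
      using dot[of x] yp by (simp add: sgn_div_norm inner_commute divide_simps mult_le_0_iff)
  qed (use fr yp in \<open>auto simp: p_def norm_sgn\<close>)
  moreover have "y - p = norm (y - p) *\<^sub>R sgn (y - p)"
    using yp by (simp add: sgn_div_norm)
  ultimately have "y - p = dist y p *\<^sub>R \<nu> p"
    by (simp only: dist_norm)
  then show "y = closest_point C y + dist y (closest_point C y) *\<^sub>R \<nu> (closest_point C y)"
    by (simp add: p_def algebra_simps)
qed

text \<open>Every point of \<open>C\<close> lies below the supporting hyperplane at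
  \<open>c\<close>, hence at distance at least \<open>t\<close>. This is the uniqueness of normal
  coordinates.\<close>

lemma closest_point_normal_ray:
  assumes c: "c \<in> frontier C" and t: "t \<ge> 0"
  shows "closest_point C (c + t *\<^sub>R \<nu> c) = c"
proof (rule closest_point_unique[OF convex closed, symmetric])
  show "c \<in> C" using c frontier_subset by blast
  show "\<forall>z\<in>C. dist (c + t *\<^sub>R \<nu> c) c \<le> dist (c + t *\<^sub>R \<nu> c) z"
  proof
    fix z assume z: "z \<in> C"
    have "t \<le> (c + t *\<^sub>R \<nu> c - z) \<bullet> \<nu> c"
      using supporting[OF c z] c by (simp add: inner_diff_left inner_add_left)
    also have "\<dots> \<le> norm (c + t *\<^sub>R \<nu> c - z)"
      using norm_cauchy_schwarz[of "c + t *\<^sub>R \<nu> c - z" "\<nu> c"] c by simp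
    finally show "dist (c + t *\<^sub>R \<nu> c) c \<le> dist (c + t *\<^sub>R \<nu> c) z"
      using t c by (simp add: dist_norm)
  qed
qed

lemma normal_ray_notin:
  assumes c: "c \<in> frontier C" and t: "t > 0"
  shows "c + t *\<^sub>R \<nu> c \<notin> C"
proof
  assume "c + t *\<^sub>R \<nu> c \<in> C"
  from supporting[OF c this] show False using c t by simp
qed

section \<open>First-order contact of the frontier with its tangent hyperplane\<close>

text \<open>The supporting half-space bounds the frontier from one side and the inner cone from the
  other. The implication inside a \<open>nhds\<close> filter allows composition with the limit of a
  map into the frontier, such as \<open>F\<close>.\<close>

lemma frontier_tangent:
  assumes c: "c \<in> frontier C" and \<epsilon>: "\<epsilon> > 0"
  shows "eventually (\<lambda>p. p \<in> frontier C \<longrightarrow> \<bar>(p - c) \<bullet> \<nu> c\<bar> \<le> \<epsilon> * norm (p - c)) (nhds c)"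
proof -
  obtain \<delta> where \<delta>: "\<delta> > 0"
    "\<And>y. \<lbrakk>norm (y - c) < \<delta>; (y - c) \<bullet> \<nu> c < - \<epsilon> * norm (y - c)\<rbrakk> \<Longrightarrow> y \<in> interior C"
    using inner_half_space[OF c \<epsilon>] by metis
  have "\<bar>(p - c) \<bullet> \<nu> c\<bar> \<le> \<epsilon> * norm (p - c)" if p: "p \<in> frontier C" "dist p c < \<delta>" for p
  proof -
    have "(p - c) \<bullet> \<nu> c \<le> 0" using supporting[OF c] p frontier_subset by blast
    moreover have "p \<notin> interior C" using p by (simp add: frontier_def)
    then have "\<not> (p - c) \<bullet> \<nu> c < - \<epsilon> * norm (p - c)" using \<delta>(2) p(2) by (auto simp: dist_norm)
    ultimately show ?thesis by simp
  qed
  then show ?thesis using \<delta>(1) by (auto simp: eventually_nhds_metric)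
qed

lemma frontier_tangent_within:
  assumes "c \<in> frontier C" "\<epsilon> > 0"
  shows "eventually (\<lambda>p. \<bar>(p - c) \<bullet> \<nu> c\<bar> \<le> \<epsilon> * norm (p - c)) (at c within frontier C)"
  using frontier_tangent[OF assms] unfolding eventually_at_filter by (rule eventually_mono) simp

text \<open>The witness is the nearest-point projection of \<open>c + s v\<close>.\<close>

lemma tangent_approx:
  assumes c: "c \<in> frontier C" and v: "v \<bullet> \<nu> c = 0" and \<epsilon>: "\<epsilon> > 0"
  obtains \<delta> where "\<delta> > 0"
    "\<And>s. \<lbrakk>0 < s; s < \<delta>\<rbrakk> \<Longrightarrow> \<exists>p\<in>frontier C. norm (p - (c + s *\<^sub>R v)) \<le> \<epsilon> * s"
proof -
  \<comment> \<open>Tilting \<open>v\<close> inwards by \<epsilon> gives points of \<open>C\<close>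
    at distance \<open>\<epsilon> * s\<close> from \<open>c + s *\<^sub>R v\<close>; the nearest
    point is no farther away.\<close>
  have "(v - \<epsilon> *\<^sub>R \<nu> c) \<bullet> \<nu> c < 0" using v \<epsilon> c by (simp add: inner_diff_left)
  then obtain \<delta> where \<delta>: "\<delta> > 0" "\<And>s. \<lbrakk>0 < s; s < \<delta>\<rbrakk> \<Longrightarrow> c + s *\<^sub>R (v - \<epsilon> *\<^sub>R \<nu> c) \<in> C"
    using inner_cone[OF c] interior_subset by (metis subsetD)
  show ?thesis
  proof (rule that[OF \<delta>(1)])
    fix s assume s: "0 < s" "s < \<delta>"
    let ?p = "closest_point C (c + s *\<^sub>R v)"
    have "dist (c + s *\<^sub>R v) ?p \<le> dist (c + s *\<^sub>R v) (c + s *\<^sub>R (v - \<epsilon> *\<^sub>R \<nu> c))"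
      using closest_point_le[OF closed \<delta>(2)[OF s]] .
    also have "\<dots> = \<epsilon> * s" using s \<epsilon> c by (simp add: dist_norm algebra_simps)
    finally have "norm (?p - (c + s *\<^sub>R v)) \<le> \<epsilon> * s" by (simp add: dist_norm norm_minus_commute)
    moreover have "?p \<in> frontier C"
    proof (cases "c + s *\<^sub>R v \<in> C")
      case True
      moreover have "c + s *\<^sub>R v \<notin> interior C" using supporting_interior[OF c] v by force
      ultimately show ?thesis using closed by (simp add: closest_point_self frontier_def)
    qed (rule closest_point_outside)
    ultimately show "\<exists>p\<in>frontier C. norm (p - (c + s *\<^sub>R v)) \<le> \<epsilon> * s" by blast
  qed
qed

section \<open>Local extensions of the outward normal\<close>

text \<open>On tangent vectors \<open>N' c\<close> is the shape operator of the frontier at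
  \<open>c\<close>. Unit length is required off the frontier too, so that \<open>N'\<close> takes
  values orthogonal to \<open>N\<close>.\<close>

definition normal_extension :: "'a set \<Rightarrow> ('a \<Rightarrow> 'a) \<Rightarrow> ('a \<Rightarrow> 'a \<Rightarrow>\<^sub>L 'a) \<Rightarrow> bool" where
  "normal_extension U N N' \<longleftrightarrow> open U \<and> (\<forall>x\<in>U. norm (N x) = 1) \<and>
     (\<forall>x\<in>U. (N has_derivative blinfun_apply (N' x)) (at x)) \<and> continuous_on U N' \<and>
     (\<forall>x\<in>frontier C \<inter> U. N x = \<nu> x)"

text \<open>The normalised gradient of a defining function is the normal up to a sign that might
  jump. An interior point \<open>z\<close> prevents this: on the open set where \<open>N\<close>
  points away from \<open>z\<close>, the supporting half-spaces exclude the wrong sign.\<close>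

lemma normal_extension_exists:
  assumes c: "c \<in> frontier C"
  obtains U N N' where "normal_extension U N N'" "c \<in> U"
proof -
  obtain U g H where U: "open U" "c \<in> U"
    and g: "\<And>x. x \<in> U \<Longrightarrow> g x \<noteq> 0"
    and H: "\<And>x. x \<in> U \<Longrightarrow> (g has_derivative blinfun_apply (H x)) (at x)"
    and cH: "continuous_on U H"
    and n: "\<And>x. x \<in> frontier C \<inter> U \<Longrightarrow> \<exists>\<sigma>. \<bar>\<sigma>\<bar> = 1 \<and> is_inward_normal C x (\<sigma> *\<^sub>R sgn (g x))"
    using local_level_set[OF c] by metis
  have cg: "continuous_on U g"
    using H by (meson continuous_at_imp_continuous_on has_derivative_continuous)
  have pm: "\<nu> x = sgn (g x) \<or> \<nu> x = - sgn (g x)" if x: "x \<in> frontier C \<inter> U" for x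
  proof -
    obtain \<sigma> where \<sigma>: "\<bar>\<sigma>\<bar> = 1" "is_inward_normal C x (\<sigma> *\<^sub>R sgn (g x))" using n[OF x] by blast
    then have "\<nu> x = - (\<sigma> *\<^sub>R sgn (g x))" by (simp add: outward_normal_def inward_normal_eqI)
    then show ?thesis using \<sigma>(1) by (auto simp: abs_if split: if_splits)
  qed
  obtain \<sigma> :: real where \<sigma>: "\<sigma> = 1 \<or> \<sigma> = - 1" "\<nu> c = \<sigma> *\<^sub>R sgn (g c)"
    using pm[of c] c U by (metis IntI scaleR_one scaleR_minus1_left)
  define N where "N x = \<sigma> *\<^sub>R sgn (g x)" for x
  define N' where "N' x = (\<sigma> / norm (g x)) *\<^sub>R (blinfun_tangent (sgn (g x)) o\<^sub>L H x)" for x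
  have cN: "continuous_on U N"
    unfolding N_def sgn_div_norm using g by (intro continuous_intros cg) auto
  obtain z where z: "z \<in> interior C" using interior_nonempty by blast
  define V where "V = {x \<in> U. (z - x) \<bullet> N x < 0}"
  have "V = U \<inter> (\<lambda>x. (z - x) \<bullet> N x) -` {..<0}" by (auto simp: V_def)
  moreover have "open \<dots>"
    by (intro continuous_open_preimage continuous_intros cN U)
  ultimately have oV: "open V" by simp
  have "normal_extension V N N'"
    unfolding normal_extension_def
  proof (intro conjI ballI oV)
    fix x assume "x \<in> V"
    then have x: "x \<in> U" by (simp add: V_def)
    show "norm (N x) = 1" using \<sigma>(1) g[OF x] by (auto simp: N_def norm_sgn)
    have "((\<lambda>x. \<sigma> *\<^sub>R sgn (g x)) has_derivative
      (\<lambda>h. \<sigma> *\<^sub>R ((H x h - (sgn (g x) \<bullet> H x h) *\<^sub>R sgn (g x)) /\<^sub>R norm (g x)))) (at x)"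
      by (intro has_derivative_scaleR_right has_derivative_compose[OF H[OF x] has_derivative_sgn[OF g[OF x]]])
    moreover have "blinfun_apply (N' x) =
      (\<lambda>h. \<sigma> *\<^sub>R ((H x h - (sgn (g x) \<bullet> H x h) *\<^sub>R sgn (g x)) /\<^sub>R norm (g x)))"
      by (simp add: fun_eq_iff N'_def blinfun.scaleR_left blinfun_tangent_apply divide_inverse)
    ultimately show "(N has_derivative blinfun_apply (N' x)) (at x)"
      by (simp add: N_def[abs_def])
  next
    show "continuous_on V N'"
    proof (rule continuous_on_subset)
      show "continuous_on U N'"
        unfolding N'_def sgn_div_norm using g by (intro continuous_intros cg cH) auto
    qed (auto simp: V_def)
  next
    fix x assume x: "x \<in> frontier C \<inter> V"
    then have xU: "x \<in> frontier C \<inter> U" and neg: "(z - x) \<bullet> N x < 0" by (auto simp: V_def)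
    have "\<nu> x = N x \<or> \<nu> x = - N x" using pm[OF xU] \<sigma>(1) by (auto simp: N_def)
    moreover have "\<nu> x \<noteq> - N x" using supporting_interior[of x z] x z neg by auto
    ultimately show "N x = \<nu> x" by simp
  qed
  moreover have "c \<in> V" using U supporting_interior[OF c z] \<sigma>(2) by (simp add: V_def N_def)
  ultimately show ?thesis using that by blast
qed

end

section \<open>Tangent vectors and gradients on the frontier\<close>

context C2_convex_core
begin

text \<open>Secants of the frontier realise every tangent vector. Such sequences take the place of
  curves in the hypersurface.\<close>

lemma tangent_sequence:
  assumes c: "c \<in> frontier C" and v: "v \<bullet> \<nu> c = 0"
  obtains p :: "nat \<Rightarrow> 'a" and s :: "nat \<Rightarrow> real" where "\<And>n. p n \<in> frontier C" "\<And>n. s n > 0"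
    "p \<longlonglongrightarrow> c" "(\<lambda>n. (p n - c) /\<^sub>R s n) \<longlonglongrightarrow> v"
proof -
  have "\<exists>s p. 0 < s \<and> s < 1 / real (Suc n) \<and> p \<in> frontier C \<and> norm (p - (c + s *\<^sub>R v)) \<le> 1 / real (Suc n) * s"
    for n
  proof -
    obtain \<delta> where \<delta>: "\<delta> > 0"
      "\<And>s. \<lbrakk>0 < s; s < \<delta>\<rbrakk> \<Longrightarrow> \<exists>p\<in>frontier C. norm (p - (c + s *\<^sub>R v)) \<le> 1 / real (Suc n) * s"
      using tangent_approx[OF c v, of "1 / real (Suc n)"] by auto
    define s where "s = min \<delta> (1 / real (Suc n)) / 2"
    have s: "0 < s" "s < \<delta>" "s < 1 / real (Suc n)" using \<delta>(1) by (auto simp: s_def min_def field_simps)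
    then show ?thesis using \<delta>(2)[OF s(1,2)] by blast
  qed
  then obtain s p where sp: "\<And>n. 0 < s n" "\<And>n. s n < 1 / real (Suc n)" "\<And>n. p n \<in> frontier C"
    "\<And>n. norm (p n - (c + s n *\<^sub>R v)) \<le> 1 / real (Suc n) * s n"
    by metis
  have s0: "s \<longlonglongrightarrow> 0"
    by (rule tendsto_sandwich[OF _ _ tendsto_const LIMSEQ_inverse_real_of_nat])
      (use sp(1,2) in \<open>auto intro!: always_eventually less_imp_le simp: inverse_eq_divide\<close>)
  have "(\<lambda>n. (p n - c) /\<^sub>R s n - v) \<longlonglongrightarrow> 0"
  proof (rule Lim_null_comparison[OF _ LIMSEQ_inverse_real_of_nat], rule always_eventually, rule allI)
    fix n
    have "(p n - c) /\<^sub>R s n - v = (p n - (c + s n *\<^sub>R v)) /\<^sub>R s n"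
      using sp(1)[of n] by (simp add: algebra_simps)
    then have "norm ((p n - c) /\<^sub>R s n - v) = norm (p n - (c + s n *\<^sub>R v)) / s n"
      using sp(1)[of n] by (simp add: divide_inverse)
    also have "\<dots> \<le> (1 / real (Suc n) * s n) / s n"
      using sp(1)[of n] sp(4)[of n] by (intro divide_right_mono) auto
    finally show "norm ((p n - c) /\<^sub>R s n - v) \<le> inverse (real (Suc n))"
      using sp(1)[of n] by (simp add: inverse_eq_divide)
  qed
  then have q: "(\<lambda>n. (p n - c) /\<^sub>R s n) \<longlonglongrightarrow> v" by (simp add: LIM_zero_iff)
  have "(\<lambda>n. c + s n *\<^sub>R ((p n - c) /\<^sub>R s n)) \<longlonglongrightarrow> c + 0 *\<^sub>R v"
    by (intro tendsto_intros s0 q)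
  moreover have "(\<lambda>n. c + s n *\<^sub>R ((p n - c) /\<^sub>R s n)) = p"
    using sp(1) by (simp add: fun_eq_iff less_imp_neq[symmetric])
  ultimately have "p \<longlonglongrightarrow> c" by simp
  then show ?thesis using that sp q by blast
qed

text \<open>The secant quotients converge and are therefore bounded, so a remainder that is small
  relative to \<open>norm (p n - c)\<close> is also small relative to \<open>s n\<close>.\<close>

lemma tendsto_tangent_quotient:
  fixes f :: "'a \<Rightarrow> 'b::real_normed_vector"
  assumes f: "(f has_derivative f') (at c within frontier C)"
    and p: "\<And>n. p n \<in> frontier C" "\<And>n. s n > 0" "p \<longlonglongrightarrow> c"
    and q: "(\<lambda>n. (p n - c) /\<^sub>R s n) \<longlonglongrightarrow> v"
  shows "(\<lambda>n. (f (p n) - f c) /\<^sub>R s n) \<longlonglongrightarrow> f' v"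
proof -
  have bl: "bounded_linear f'" using f by (rule has_derivative_bounded_linear)
  interpret f': bounded_linear f' by (rule bl)
  let ?r = "\<lambda>n. (f (p n) - f c - f' (p n - c)) /\<^sub>R s n"
  have "\<exists>B>0. \<forall>n. norm ((p n - c) /\<^sub>R s n) \<le> B"
    using convergent_imp_Bseq[OF convergentI[OF q]] unfolding Bseq_def .
  then obtain B where B: "B > 0" "\<And>n. norm ((p n - c) /\<^sub>R s n) \<le> B" by auto
  have "?r \<longlonglongrightarrow> 0"
  proof (rule tendstoI)
    fix e :: real assume e: "e > 0"
    then have "e / (2 * B) > 0" using B by simp
    then obtain \<delta> where \<delta>: "\<delta> > 0" "\<And>y. \<lbrakk>y \<in> frontier C; norm (y - c) < \<delta>\<rbrakk> \<Longrightarrow>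
        norm (f y - f c - f' (y - c)) \<le> e / (2 * B) * norm (y - c)"
      using f[unfolded has_derivative_within_alt, THEN conjunct2, rule_format, of "e / (2 * B)"] by blast
    have ev: "eventually (\<lambda>n. dist (p n) c < \<delta>) sequentially"
      using tendstoD[OF p(3) \<delta>(1)] .
    show "eventually (\<lambda>n. dist (?r n) 0 < e) sequentially"
      using ev
    proof eventually_elim
      case (elim n)
      have "norm (?r n) = norm (f (p n) - f c - f' (p n - c)) / s n"
        using p(2)[of n] by (simp only: norm_scaleR) (simp add: divide_inverse)
      also have "\<dots> \<le> e / (2 * B) * norm (p n - c) / s n"
        using elim p(1) order_less_imp_le[OF p(2)]
        by (intro divide_right_mono \<delta>) (simp_all add: dist_norm)
      also have "\<dots> = e / (2 * B) * (norm (p n - c) / s n)" by (rule times_divide_eq_right[symmetric])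
      also have "norm (p n - c) / s n = norm ((p n - c) /\<^sub>R s n)"
        using p(2)[of n] by (simp add: divide_inverse)
      also have "e / (2 * B) * norm ((p n - c) /\<^sub>R s n) \<le> e / (2 * B) * B"
        by (rule mult_left_mono[OF B(2)]) (use B(1) e in simp)
      also have "\<dots> < e" using B e by simp
      finally show ?case by (simp only: dist_norm diff_0_right)
    qed
  qed
  then have "(\<lambda>n. ?r n + f' ((p n - c) /\<^sub>R s n)) \<longlonglongrightarrow> 0 + f' v"
    by (intro tendsto_add f'.tendsto q)
  moreover have "?r n + f' ((p n - c) /\<^sub>R s n) = (f (p n) - f c) /\<^sub>R s n" for n
    by (simp add: f'.scaleR scaleR_diff_right[symmetric] del: scaleR_diff_right flip: scaleR_add_right)
  ultimately show ?thesis by simp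
qed

text \<open>Derivatives within the frontier are determined on tangent vectors, and
  \<open>g - k\<close> is one of them.\<close>

lemma gradient_unique:
  assumes c: "c \<in> frontier C"
    and g: "g \<in> tangent_space C c" "(f has_derivative (\<lambda>h. g \<bullet> h)) (at c within frontier C)"
    and k: "k \<in> tangent_space C c" "(f has_derivative (\<lambda>h. k \<bullet> h)) (at c within frontier C)"
  shows "g = k"
proof -
  have "(g - k) \<bullet> \<nu> c = 0" using g k by (simp add: tangent_space_def inner_diff_left)
  obtain p s where p: "\<And>n. p n \<in> frontier C" "\<And>n. s n > 0" "p \<longlonglongrightarrow> c"
    "(\<lambda>n. (p n - c) /\<^sub>R s n) \<longlonglongrightarrow> g - k"
    by (rule tangent_sequence[OF c \<open>(g - k) \<bullet> \<nu> c = 0\<close>]) (rule that)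
  have "g \<bullet> (g - k) = k \<bullet> (g - k)"
    using tendsto_tangent_quotient[OF g(2) p] tendsto_tangent_quotient[OF k(2) p] LIMSEQ_unique by blast
  then have "(g - k) \<bullet> (g - k) = 0" by (simp add: inner_diff_left)
  then show ?thesis by simp
qed

lemma riemannian_gradient_eqI:
  assumes "c \<in> frontier C" "g \<in> tangent_space C c"
    "(f has_derivative (\<lambda>h. g \<bullet> h)) (at c within frontier C)"
  shows "riemannian_gradient C f c = g"
  unfolding riemannian_gradient_def using assms(2,3)
  by (intro the_equality) (auto intro: gradient_unique[OF assms(1)])

text \<open>The frontier is flat to first order, so a derivative within it may be altered by any
  multiple of \<open>h \<bullet> \<nu> c\<close>. This is what permits replacing an ambient gradient
  by its tangential part.\<close>

lemma zero_has_normal_derivative: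
  assumes "c \<in> frontier C"
  shows "((\<lambda>x. 0::real) has_derivative (\<lambda>h. h \<bullet> \<nu> c)) (at c within frontier C)"
  unfolding has_derivative_within_alt2
  using frontier_tangent_within[OF assms] by (simp add: bounded_linear_inner_left)

text \<open>\<open>E\<close> is the ambient gradient without its normal component. Using
  \<open>N\<close> instead of \<open>\<nu>\<close> makes \<open>E\<close> differentiable at
  \<open>c\<close> in the ambient sense.\<close>

lemma local_gradient:
  assumes f: "C2_on_hypersurface (frontier C) f" and c: "c \<in> frontier C"
  obtains U E where "open U" "c \<in> U" "E differentiable (at c)"
    "\<And>p. p \<in> frontier C \<inter> U \<Longrightarrow> E p \<in> tangent_space C p"
    "\<And>p. p \<in> frontier C \<inter> U \<Longrightarrow> (f has_derivative (\<lambda>h. E p \<bullet> h)) (at p within frontier C)"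
proof -
  obtain V k where V: "open V" "c \<in> V" and k: "C2_on V k" and kf: "\<And>x. x \<in> frontier C \<inter> V \<Longrightarrow> k x = f x"
    using bspec[OF f[unfolded C2_on_hypersurface_def] c] by metis
  obtain G and H :: "'a \<Rightarrow> 'a \<Rightarrow>\<^sub>L 'a" where G: "\<And>x. x \<in> V \<Longrightarrow> GDERIV k x :> G x"
    and H: "\<And>x. x \<in> V \<Longrightarrow> (G has_derivative blinfun_apply (H x)) (at x)"
    using k[unfolded C2_on_def] by metis
  obtain W N N' where W: "normal_extension W N N'" "c \<in> W" using normal_extension_exists[OF c] .
  define E where "E p = G p - (N p \<bullet> G p) *\<^sub>R N p" for p
  show ?thesis
  proof (rule that[of "V \<inter> W" E])
    show "open (V \<inter> W)" using V W by (auto simp: normal_extension_def)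
    show "c \<in> V \<inter> W" using V W by auto
    have "G differentiable (at c)" "N differentiable (at c)"
      using differentiableI[OF H[OF V(2)]] W by (auto simp: normal_extension_def intro: differentiableI)
    then show "E differentiable (at c)"
      unfolding E_def by (intro differentiable_diff differentiable_scaleR differentiable_inner)
  next
    fix p assume p: "p \<in> frontier C \<inter> (V \<inter> W)"
    then have Np: "N p = \<nu> p" using W by (auto simp: normal_extension_def)
    show "E p \<in> tangent_space C p"
      using p by (simp add: tangent_space_def E_def Np inner_diff_left inner_commute[of "G p" "\<nu> p"])
    have pV: "p \<in> V" and pC: "p \<in> frontier C" using p by auto
    have dk: "(k has_derivative (\<lambda>h. h \<bullet> G p)) (at p within frontier C)"
      using G[OF pV] unfolding gderiv_def by (rule has_derivative_at_withinI)
    obtain r where r: "r > 0" "ball p r \<subseteq> V" using openE[OF V(1) pV] by metis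
    have eq: "k x = f x" if "x \<in> frontier C" "dist x p < r" for x
      using that r by (intro kf) (auto simp: dist_commute)
    have "(f has_derivative (\<lambda>h. h \<bullet> G p)) (at p within frontier C)"
      by (rule has_derivative_transform_within[OF dk r(1) pC eq])
    \<comment> \<open>Subtracting a multiple of the zero function leaves \<open>f\<close> unchanged
      but removes the normal component from its derivative.\<close>
    then have "((\<lambda>x. f x - (\<nu> p \<bullet> G p) * 0) has_derivative (\<lambda>h. h \<bullet> G p - (\<nu> p \<bullet> G p) * (h \<bullet> \<nu> p)))
        (at p within frontier C)"
      using p by (intro has_derivative_diff has_derivative_mult_right zero_has_normal_derivative) auto
    moreover have "(\<lambda>h. h \<bullet> G p - (\<nu> p \<bullet> G p) * (h \<bullet> \<nu> p)) = (\<lambda>h. E p \<bullet> h)"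
      by (rule ext) (simp only: E_def Np inner_diff_left inner_scaleR_left, simp only: inner_commute)
    ultimately show "(f has_derivative (\<lambda>h. E p \<bullet> h)) (at p within frontier C)" by simp
  qed
qed

section \<open>The shape operator and the derivative of the normal map\<close>

text \<open>Differentiate \<open>N y \<bullet> N y = 1\<close>.\<close>

lemma normal_extension_tangent:
  assumes ext: "normal_extension U N N'" and x: "x \<in> U"
  shows "N x \<bullet> N' x v = 0"
proof -
  have "((\<lambda>y. N y \<bullet> N y) has_derivative (\<lambda>h. N x \<bullet> N' x h + N' x h \<bullet> N x)) (at x)"
    using ext x unfolding normal_extension_def by (intro has_derivative_inner) auto
  moreover have "((\<lambda>y. N y \<bullet> N y) has_derivative (\<lambda>h. 0)) (at x)"
  proof (rule has_derivative_transform_within_open[of "\<lambda>y. 1"])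
    show "open U" "x \<in> U" using ext x by (auto simp: normal_extension_def)
    show "\<And>y. y \<in> U \<Longrightarrow> 1 = N y \<bullet> N y" using ext by (simp add: normal_extension_def dot_square_norm)
  qed (rule has_derivative_const)
  ultimately have "(\<lambda>h. N x \<bullet> N' x h + N' x h \<bullet> N x) = (\<lambda>h. 0)" by (rule has_derivative_unique)
  then have "N x \<bullet> N' x v + N' x v \<bullet> N x = 0" by (rule fun_cong)
  then show ?thesis by (simp add: inner_commute)
qed

text \<open>Differentiates the monotonicity of the field of outward normals of a convex set.\<close>

lemma normal_extension_nonneg:
  assumes ext: "normal_extension U N N'" and c: "c \<in> frontier C" "c \<in> U" and v: "v \<bullet> \<nu> c = 0"
  shows "v \<bullet> N' c v \<ge> 0"
proof -
  have oU: "open U" using ext by (simp add: normal_extension_def)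
  obtain p s where p: "\<And>n. p n \<in> frontier C" "\<And>n. s n > 0" "p \<longlonglongrightarrow> c"
    "(\<lambda>n. (p n - c) /\<^sub>R s n) \<longlonglongrightarrow> v"
    by (rule tangent_sequence[OF c(1) v]) (rule that)
  have "(N has_derivative N' c) (at c within frontier C)"
    using ext c by (auto simp: normal_extension_def intro: has_derivative_at_withinI)
  then have "(\<lambda>n. (N (p n) - N c) /\<^sub>R s n) \<longlonglongrightarrow> N' c v"
    by (rule tendsto_tangent_quotient[OF _ p])
  then have "(\<lambda>n. ((p n - c) /\<^sub>R s n) \<bullet> ((N (p n) - N c) /\<^sub>R s n)) \<longlonglongrightarrow> v \<bullet> N' c v"
    by (intro tendsto_inner p)
  moreover have "eventually (\<lambda>n. 0 \<le> ((p n - c) /\<^sub>R s n) \<bullet> ((N (p n) - N c) /\<^sub>R s n)) sequentially"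
    using topological_tendstoD[OF p(3) oU c(2)]
  proof eventually_elim
    case (elim n)
    have N: "N (p n) = \<nu> (p n)" "N c = \<nu> c" using ext elim p(1) c by (auto simp: normal_extension_def)
    \<comment> \<open>The sum of the two support inequalities is the monotonicity of the
      normal.\<close>
    have "(c - p n) \<bullet> \<nu> (p n) \<le> 0" "(p n - c) \<bullet> \<nu> c \<le> 0"
      using p(1) c frontier_subset by (auto intro!: supporting)
    then have "0 \<le> (p n - c) \<bullet> (N (p n) - N c)" by (simp add: N inner_diff)
    then show ?case using p(2)[of n] by (simp add: zero_le_mult_iff)
  qed
  ultimately show ?thesis by (rule tendsto_lowerbound) simp
qed

text \<open>With \<open>S\<close> the derivative of the normal field, this is on tangent vectors the
  derivative of the map sending \<open>c\<close> to \<open>c + t *\<^sub>R \<nu> c\<close>. The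
  projection extends it by the identity along a unit vector \<open>n\<close>, so that it can be
  inverted on the whole space.\<close>

definition normal_map_derivative :: "real \<Rightarrow> 'a \<Rightarrow> ('a \<Rightarrow>\<^sub>L 'a) \<Rightarrow> ('a \<Rightarrow>\<^sub>L 'a)" where
  "normal_map_derivative t n S = id_blinfun + t *\<^sub>R (S o\<^sub>L blinfun_tangent n)"

lemma normal_map_derivative_apply:
  "normal_map_derivative t n S v = v + t *\<^sub>R S (v - (n \<bullet> v) *\<^sub>R n)"
  by (simp add: normal_map_derivative_def blinfun.add_left blinfun.scaleR_left blinfun_tangent_apply)

text \<open>\<open>N' c\<close> has values orthogonal to \<open>\<nu> c\<close>, so the pairing sees
  only the tangential part of \<open>v\<close>, where the shape operator is nonnegative.\<close>

lemma normal_map_derivative_coercive: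
  assumes ext: "normal_extension U N N'" and c: "c \<in> frontier C" "c \<in> U" and t: "t \<ge> 0"
  shows "v \<bullet> normal_map_derivative t (\<nu> c) (N' c) v \<ge> (norm v)\<^sup>2"
proof -
  let ?v = "v - (\<nu> c \<bullet> v) *\<^sub>R \<nu> c"
  have "N c = \<nu> c" using ext c by (auto simp: normal_extension_def)
  then have "\<nu> c \<bullet> N' c ?v = 0" using normal_extension_tangent[OF ext c(2)] by simp
  then have "v \<bullet> N' c ?v = ?v \<bullet> N' c ?v" by (simp add: inner_diff_left)
  also have "\<dots> \<ge> 0"
    using c(1) by (intro normal_extension_nonneg[OF ext c])
      (simp add: inner_diff_left inner_commute[of v "\<nu> c"])
  finally show ?thesis
    using t by (simp add: normal_map_derivative_apply inner_add_right dot_square_norm)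
qed

text \<open>Coercivity makes the adjoint injective, hence onto in finite dimension; \<open>R\<close>
  is a linear right inverse of it. Linearity of \<open>R\<close> is needed when it enters a
  derivative.\<close>

lemma normal_map_derivative_adjoint_inverse:
  assumes ext: "normal_extension U N N'" and c: "c \<in> frontier C" "c \<in> U" and t: "t \<ge> 0"
  obtains R where "linear R" "\<And>y v. R y \<bullet> normal_map_derivative t (\<nu> c) (N' c) v = y \<bullet> v"
proof -
  let ?B = "blinfun_apply (normal_map_derivative t (\<nu> c) (N' c))"
  have lin: "linear ?B" by (simp add: blinfun.bounded_linear_right bounded_linear.linear)
  have adj: "w \<bullet> ?B v = adjoint ?B w \<bullet> v" for w v
    using adjoint_works[OF lin] by (simp add: inner_commute)
  have "adjoint ?B w = 0 \<Longrightarrow> w = 0" for w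
    using normal_map_derivative_coercive[OF ext c t, of w] adj[of w w] by simp
  then have "surj (adjoint ?B)"
    using adjoint_linear[OF lin] by (simp add: linear_injective_0 linear_injective_imp_surjective)
  then obtain R where R: "linear R" "adjoint ?B \<circ> R = id"
    using linear_surjective_right_inverse[OF adjoint_linear[OF lin]] by blast
  have "R y \<bullet> ?B v = y \<bullet> v" for y v
    using fun_cong[OF R(2), of y] by (simp add: adj)
  then show ?thesis using that R(1) by blast
qed

text \<open>The vector \<open>w\<close> is the gradient at \<open>c + t \<nu> c\<close> of the extension of a function on the frontier
  that is constant along normal rays.\<close>

lemma transported_gradient_exists:
  assumes ext: "normal_extension U N N'" and c: "c \<in> frontier C" "c \<in> U" and t: "t \<ge> 0"
    and D: "D \<bullet> \<nu> c = 0"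
  obtains w where "\<And>v. w \<bullet> normal_map_derivative t (\<nu> c) (N' c) v = D \<bullet> v"
    "w \<bullet> \<nu> c = 0" "norm w \<le> norm D"
proof -
  let ?B = "blinfun_apply (normal_map_derivative t (\<nu> c) (N' c))"
  obtain R where "\<And>y v. R y \<bullet> ?B v = y \<bullet> v"
    using normal_map_derivative_adjoint_inverse[OF ext c t] by metis
  then obtain w where w: "\<And>v. w \<bullet> ?B v = D \<bullet> v" by blast
  \<comment> \<open>The operator fixes \<open>\<nu> c\<close>.\<close>
  have "w \<bullet> \<nu> c = 0"
    using w[of "\<nu> c"] D c(1) by (simp add: normal_map_derivative_apply blinfun.zero_right)
  moreover have "norm w \<le> norm D"
  proof -
    have "(norm w)\<^sup>2 \<le> D \<bullet> w" using normal_map_derivative_coercive[OF ext c t, of w] w by simp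
    also have "\<dots> \<le> norm D * norm w" by (rule norm_cauchy_schwarz)
    finally show ?thesis by (cases "w = 0") (auto simp: power2_eq_square)
  qed
  ultimately show ?thesis using that w by blast
qed

end

section \<open>The boundary of the domain in normal coordinates\<close>

locale C2_thickness_domain = C2_convex_core +
  fixes \<Omega> :: "'a set"
  assumes in_class: "\<Omega> \<in> class_O C" and C2_thickness: "C2_thickness C \<Omega>"
begin

abbreviation d :: "'a \<Rightarrow> real" where "d \<equiv> thickness C \<Omega>"
abbreviation \<Phi> :: "'a \<Rightarrow> 'a" where "\<Phi> \<equiv> radial_map C \<Omega>"
abbreviation F :: "'a \<Rightarrow> 'a" where "F \<equiv> return_map C \<Omega>"
abbreviation grad_d :: "'a \<Rightarrow> 'a" where "grad_d \<equiv> riemannian_gradient C (thickness C \<Omega>)"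

lemma open_domain: "open \<Omega>"
  and connected_ray: "c \<in> frontier C \<Longrightarrow> connected ({c + t *\<^sub>R \<nu> c | t. t \<ge> 0} \<inter> \<Omega>)"
  using in_class by (auto simp: class_O_def)

lemma bdd: "c \<in> frontier C \<Longrightarrow> bdd_above (insert 0 (thickness_set C \<Omega> c))"
  using C2_thickness by (simp add: C2_thickness_def)

lemma thickness_nonneg: "c \<in> frontier C \<Longrightarrow> d c \<ge> 0"
  unfolding thickness_def by (rule cSup_upper[OF _ bdd]) auto

text \<open>\<open>\<Omega>\<close> is open, so the supremum defining the thickness is not attained;
  in particular \<open>\<Phi> c\<close> lies outside \<open>\<Omega>\<close>.\<close>

lemma less_thickness:
  assumes c: "c \<in> frontier C" and t: "t \<ge> 0" "c + t *\<^sub>R \<nu> c \<in> \<Omega>"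
  shows "t < d c"
proof -
  obtain r where r: "r > 0" "ball (c + t *\<^sub>R \<nu> c) r \<subseteq> \<Omega>"
    using openE[OF open_domain t(2)] by metis
  have "c + (t + r/2) *\<^sub>R \<nu> c \<in> \<Omega>"
    using r(1) c by (intro subsetD[OF r(2)]) (simp add: dist_norm algebra_simps)
  then have "t + r/2 \<in> insert 0 (thickness_set C \<Omega> c)"
    using t r by (simp add: thickness_set_def)
  then have "t + r/2 \<le> d c" unfolding thickness_def by (rule cSup_upper[OF _ bdd[OF c]])
  then show ?thesis using r by simp
qed

text \<open>The functional \<open>(z - c) \<bullet> \<nu> c\<close> reads off the ray parameter, so
  the connected section becomes an interval. A starting height \<open>t0\<close> must be supplied
  because \<open>c\<close> itself need not belong to \<open>\<Omega>\<close>.\<close>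

lemma thickness_set_interval:
  assumes c: "c \<in> frontier C" and t0: "0 \<le> t0" "c + t0 *\<^sub>R \<nu> c \<in> \<Omega>" and t: "t0 \<le> t" "t < d c"
  shows "c + t *\<^sub>R \<nu> c \<in> \<Omega>"
proof -
  let ?R = "{c + t *\<^sub>R \<nu> c | t. t \<ge> 0} \<inter> \<Omega>"
  have "\<exists>t1\<in>insert 0 (thickness_set C \<Omega> c). t < t1"
    using t(2) less_cSup_iff[OF _ bdd[OF c]] by (simp add: thickness_def)
  then obtain t1 where t1: "t < t1" "c + t1 *\<^sub>R \<nu> c \<in> \<Omega>" "0 \<le> t1"
    using t t0 by (auto simp: thickness_set_def)
  have "connected ((\<lambda>z. (z - c) \<bullet> \<nu> c) ` ?R)"
    by (intro connected_continuous_image connected_ray[OF c] continuous_intros)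
  moreover have "s \<in> (\<lambda>z. (z - c) \<bullet> \<nu> c) ` ?R" if "0 \<le> s" "c + s *\<^sub>R \<nu> c \<in> \<Omega>" for s
    by (rule rev_image_eqI[of "c + s *\<^sub>R \<nu> c"]) (use that c in auto)
  then have "t0 \<in> (\<lambda>z. (z - c) \<bullet> \<nu> c) ` ?R" "t1 \<in> (\<lambda>z. (z - c) \<bullet> \<nu> c) ` ?R"
    using t0 t1 by blast+
  ultimately have "t \<in> (\<lambda>z. (z - c) \<bullet> \<nu> c) ` ?R"
    using t(1) t1(1) connectedD_interval[of _ t0 t1 t] by simp
  then show ?thesis using c by auto
qed

lemma domain_imp_dist_less:
  assumes "y \<notin> C" "y \<in> \<Omega>"
  shows "dist y (closest_point C y) < d (closest_point C y)"
  using closest_point_outside[OF assms(1)] assms(2) by (intro less_thickness) auto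

lemma radial_map_notin:
  assumes "c \<in> frontier C"
  shows "\<Phi> c \<notin> \<Omega>"
  using less_thickness[OF assms thickness_nonneg[OF assms]] by (auto simp: radial_map_def)

lemma closest_point_radial_map: "c \<in> frontier C \<Longrightarrow> closest_point C (\<Phi> c) = c"
  by (simp add: radial_map_def closest_point_normal_ray thickness_nonneg)

lemma dist_radial_map: "c \<in> frontier C \<Longrightarrow> dist (\<Phi> c) c = d c"
  by (simp add: radial_map_def dist_norm thickness_nonneg)

lemma grad_d:
  assumes "c \<in> frontier C"
  shows "grad_d c \<bullet> \<nu> c = 0"
    and "(d has_derivative (\<lambda>h. grad_d c \<bullet> h)) (at c within frontier C)"
    and "grad_d differentiable (at c within frontier C)"
proof -
  have C2: "C2_on_hypersurface (frontier C) d" using C2_thickness by (simp add: C2_thickness_def)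
  obtain U E where U: "open U" "c \<in> U" and E: "E differentiable (at c)"
    "\<And>p. p \<in> frontier C \<inter> U \<Longrightarrow> E p \<in> tangent_space C p"
    "\<And>p. p \<in> frontier C \<inter> U \<Longrightarrow> (d has_derivative (\<lambda>h. E p \<bullet> h)) (at p within frontier C)"
    by (rule local_gradient[OF C2 assms]) (rule that)
  have eq: "grad_d p = E p" if "p \<in> frontier C \<inter> U" for p
    using that by (intro riemannian_gradient_eqI E) auto
  show "grad_d c \<bullet> \<nu> c = 0" "(d has_derivative (\<lambda>h. grad_d c \<bullet> h)) (at c within frontier C)"
    using E(2,3)[of c] eq[of c] assms U by (auto simp: tangent_space_def)
  obtain E' where E': "(E has_derivative E') (at c)" using E(1) by (auto simp: differentiable_def)
  obtain r where r: "r > 0" "ball c r \<subseteq> U" using openE[OF U] by metis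
  have "E x = grad_d x" if "x \<in> frontier C" "dist x c < r" for x
    using that r by (subst eq) (auto simp: dist_commute)
  then have "(grad_d has_derivative E') (at c within frontier C)"
    by (rule has_derivative_transform_within[OF has_derivative_at_withinI[OF E'] r(1) assms])
  then show "grad_d differentiable (at c within frontier C)" by (auto simp: differentiable_def)
qed

lemma continuous_thickness: "c \<in> frontier C \<Longrightarrow> (d \<longlongrightarrow> d c) (at c within frontier C)"
  using has_derivative_continuous[OF grad_d(2)] by (simp add: continuous_within)

lemma grad_d_zero:
  assumes c: "c \<in> frontier C" and d: "d c = 0"
  shows "grad_d c = 0"
proof -
  \<comment> \<open>Along secants in the downhill direction the quotients of \<open>d\<close> are
    nonnegative, while their limit is minus the squared length of the gradient.\<close>
  have "- grad_d c \<bullet> \<nu> c = 0" using grad_d(1)[OF c] by simp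
  from tangent_sequence[OF c this]
  obtain p s where p: "\<And>n. p n \<in> frontier C" "\<And>n. s n > 0" "p \<longlonglongrightarrow> c"
    "(\<lambda>n. (p n - c) /\<^sub>R s n) \<longlonglongrightarrow> - grad_d c" by metis
  have nonneg: "0 \<le> (d (p n) - d c) /\<^sub>R s n" for n
    using thickness_nonneg[OF p(1)[of n]] p(2)[of n] d by simp
  have "(\<lambda>n. (d (p n) - d c) /\<^sub>R s n) \<longlonglongrightarrow> grad_d c \<bullet> - grad_d c"
    by (rule tendsto_tangent_quotient[OF grad_d(2)[OF c] p])
  then have "0 \<le> grad_d c \<bullet> - grad_d c"
    using nonneg by (intro tendsto_lowerbound[OF _ always_eventually]) auto
  then have "grad_d c \<bullet> grad_d c \<le> 0" by simp
  then show ?thesis using inner_ge_zero[of "grad_d c"] by (metis order_antisym inner_eq_zero_iff)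
qed

text \<open>One point of the normal ray at \<open>c\<close> below \<open>\<Phi> c\<close> lies in \<open>\<Omega>\<close>; by openness so do the points at the
  same height over nearby \<open>p\<close>, and connectedness of the rays fills in everything between.\<close>

lemma domain_near_radial_map:
  assumes c: "c \<in> frontier C" and d: "d c > 0"
  shows "eventually (\<lambda>y. y \<notin> C \<and>
    (y \<in> \<Omega> \<longleftrightarrow> d (closest_point C y) - dist y (closest_point C y) > 0)) (nhds (\<Phi> c))"
proof -
  let ?x = "\<Phi> c"
  have xC: "?x \<notin> C" using normal_ray_notin[OF c d] by (simp add: radial_map_def)
  have "\<exists>t\<in>insert 0 (thickness_set C \<Omega> c). 0 < t"
    using d less_cSup_iff[OF _ bdd[OF c]] by (simp add: thickness_def)
  then obtain t0 where t0: "0 < t0" "c + t0 *\<^sub>R \<nu> c \<in> \<Omega>" by (auto simp: thickness_set_def)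
  have t0d: "t0 < d c" using less_thickness[OF c _ t0(2)] t0(1) by simp
  obtain U N N' where ext: "normal_extension U N N'" and cU: "c \<in> U" using normal_extension_exists[OF c] .
  have oU: "open U" and Nd: "(N has_derivative N' c) (at c)" and N\<nu>: "\<And>p. p \<in> frontier C \<inter> U \<Longrightarrow> N p = \<nu> p"
    using ext cU by (auto simp: normal_extension_def)
  have P: "(closest_point C \<longlongrightarrow> c) (at ?x)"
    using continuous_at_closest_point[OF convex closed nonempty, of ?x] closest_point_radial_map[OF c]
    by (simp add: isCont_def)
  \<comment> \<open>\<open>N\<close> replaces \<open>\<nu>\<close> because its continuity is
    available; the two agree at frontier points in \<open>U\<close>.\<close>
  have Q: "((\<lambda>y. closest_point C y + t0 *\<^sub>R N (closest_point C y)) \<longlongrightarrow> c + t0 *\<^sub>R N c) (at ?x)"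
    by (intro tendsto_intros P isCont_tendsto_compose[OF has_derivative_continuous[OF Nd]])
  have D: "((\<lambda>y. dist y (closest_point C y)) \<longlongrightarrow> d c) (at ?x)"
    using tendsto_dist[OF tendsto_ident_at P] by (simp add: dist_radial_map[OF c])
  have "eventually (\<lambda>y. y \<notin> C) (at ?x)"
    using topological_tendstoD[OF tendsto_ident_at, of "- C" ?x UNIV] closed xC by auto
  moreover have "eventually (\<lambda>y. closest_point C y \<in> U) (at ?x)"
    using topological_tendstoD[OF P oU cU] .
  moreover have "eventually (\<lambda>y. closest_point C y + t0 *\<^sub>R N (closest_point C y) \<in> \<Omega>) (at ?x)"
    using topological_tendstoD[OF Q open_domain] N\<nu>[of c] c cU t0 by auto
  moreover have "eventually (\<lambda>y. t0 < dist y (closest_point C y)) (at ?x)"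
    using order_tendstoD(1)[OF D t0d] .
  ultimately have "eventually (\<lambda>y. y \<notin> C \<and>
    (y \<in> \<Omega> \<longleftrightarrow> d (closest_point C y) - dist y (closest_point C y) > 0)) (at ?x)"
  proof eventually_elim
    case (elim y)
    let ?p = "closest_point C y"
    note p = closest_point_outside[OF elim(1)]
    have "y \<in> \<Omega>" if "dist y ?p < d ?p"
    proof -
      have "?p + dist y ?p *\<^sub>R \<nu> ?p \<in> \<Omega>"
        by (rule thickness_set_interval[OF p(1) _ _ _ that, of t0])
          (use elim t0 N\<nu>[of ?p] p(1) in auto)
      then show ?thesis using p(2) by simp
    qed
    then show ?case using domain_imp_dist_less[OF elim(1)] elim(1) by auto
  qed
  then show ?thesis
    using xC radial_map_notin[OF c] closest_point_radial_map[OF c] dist_radial_map[OF c]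
    by (auto simp: eventually_nhds_conv_at)
qed

text \<open>Both the nearest point and the distance to \<open>C\<close> are 1-Lipschitz, so their
  increments \<open>k\<close> and \<open>\<tau>\<close> are bounded by \<open>norm h\<close>, and
  all first-order remainders at \<open>c\<close> are negligible against \<open>norm h\<close>. The
  equation for \<open>w\<close> turns \<open>grad_d c \<bullet> k\<close> into
  \<open>w \<bullet> h\<close> up to such remainders.\<close>

lemma dist_radial_map_derivative:
  assumes ext: "normal_extension U N N'" and c: "c \<in> frontier C" "c \<in> U" and d: "d c > 0"
    and w: "\<And>v. w \<bullet> normal_map_derivative (d c) (\<nu> c) (N' c) v = grad_d c \<bullet> v" "w \<bullet> \<nu> c = 0"
  shows "((\<lambda>y. d (closest_point C y) - dist y (closest_point C y)) has_derivative
    (\<lambda>h. (w - \<nu> c) \<bullet> h)) (at (\<Phi> c))"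
  unfolding has_derivative_within_alt2
proof (intro conjI allI impI)
  show "bounded_linear (\<lambda>h. (w - \<nu> c) \<bullet> h)" by (rule bounded_linear_inner_right)
next
  fix e :: real assume e: "0 < e"
  \<comment> \<open>\<open>K\<close> sums the coefficients of the seven error terms in the final
    identity.\<close>
  define K where "K = 3 + d c + d c * norm w * norm (N' c (\<nu> c)) + d c * norm w + norm w"
  have K: "K > 0" using d by (simp add: K_def add_pos_nonneg)
  define \<eta> where "\<eta> = e / K"
  have \<eta>: "\<eta> > 0" "\<eta> * K = e" using K e by (auto simp: \<eta>_def)
  have Nc: "N c = \<nu> c" and Nd: "(N has_derivative N' c) (at c within frontier C)"
    using ext c by (auto simp: normal_extension_def intro: has_derivative_at_withinI)
  have Ncont: "(N \<longlongrightarrow> N c) (at c within frontier C)"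
    using has_derivative_continuous[OF Nd] by (simp add: continuous_within)
  have oU: "open U" using ext by (simp add: normal_extension_def)
  have "eventually (\<lambda>p. norm (d p - d c - grad_d c \<bullet> (p - c)) \<le> \<eta> * norm (p - c) \<and>
    norm (N p - N c - N' c (p - c)) \<le> \<eta> * norm (p - c) \<and>
    \<bar>(p - c) \<bullet> \<nu> c\<bar> \<le> \<eta> * norm (p - c) \<and> dist (N p) (N c) < \<eta> \<and> p \<in> U) (at c within frontier C)"
    using grad_d(2)[OF c(1)] Nd frontier_tangent_within[OF c(1) \<eta>(1)] tendstoD[OF Ncont \<eta>(1)] \<eta>(1)
      topological_tendstoD[OF tendsto_ident_at oU c(2)]
    unfolding has_derivative_within_alt2 by (intro eventually_conj) auto
  then obtain \<delta> where \<delta>: "\<delta> > 0" and near': "\<And>p. \<lbrakk>p \<in> frontier C; p \<noteq> c; dist p c < \<delta>\<rbrakk> \<Longrightarrow>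
    norm (d p - d c - grad_d c \<bullet> (p - c)) \<le> \<eta> * norm (p - c) \<and>
    norm (N p - N c - N' c (p - c)) \<le> \<eta> * norm (p - c) \<and>
    \<bar>(p - c) \<bullet> \<nu> c\<bar> \<le> \<eta> * norm (p - c) \<and> dist (N p) (N c) < \<eta> \<and> p \<in> U"
    unfolding eventually_at by metis
  have near: "norm (d p - d c - grad_d c \<bullet> (p - c)) \<le> \<eta> * norm (p - c) \<and>
    norm (N p - N c - N' c (p - c)) \<le> \<eta> * norm (p - c) \<and>
    \<bar>(p - c) \<bullet> \<nu> c\<bar> \<le> \<eta> * norm (p - c) \<and> dist (N p) (N c) < \<eta> \<and> p \<in> U"
    if "p \<in> frontier C" "dist p c < \<delta>" for p
  \<comment> \<open>The filter \<open>at c\<close> omits \<open>c\<close>, but the nearest point of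
    \<open>y\<close> is \<open>c\<close> when \<open>y\<close> moves along the normal ray.\<close>
  proof (cases "p = c")
    case True
    then show ?thesis using c \<eta> by (simp add: blinfun.zero_right)
  qed (use near' that in blast)
  have "eventually (\<lambda>y. dist y (\<Phi> c) < \<delta>) (at (\<Phi> c))"
    using \<delta> by (auto simp: eventually_at)
  moreover have "eventually (\<lambda>y. y \<notin> C) (at (\<Phi> c))"
    using domain_near_radial_map[OF c(1) d] by (simp add: eventually_nhds_conv_at eventually_conj_iff)
  ultimately show "eventually (\<lambda>y. norm (d (closest_point C y) - dist y (closest_point C y)
      - (d (closest_point C (\<Phi> c)) - dist (\<Phi> c) (closest_point C (\<Phi> c)))
      - (w - \<nu> c) \<bullet> (y - \<Phi> c)) \<le> e * norm (y - \<Phi> c)) (at (\<Phi> c))"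
  proof eventually_elim
    case (elim y)
    define p where "p = closest_point C y"
    define k where "k = p - c"
    define h where "h = y - \<Phi> c"
    define \<tau> where "\<tau> = dist y p - d c"
    define r1 where "r1 = N p - N c - N' c k"
    define r2 where "r2 = d p - d c - grad_d c \<bullet> k"
    define r3 where "r3 = k \<bullet> \<nu> c"
    define \<Delta> where "\<Delta> = N p - N c"
    have p: "p \<in> frontier C" "y = p + dist y p *\<^sub>R \<nu> p"
      unfolding p_def using closest_point_outside[OF elim(2)] .
    have kh: "norm k \<le> norm h"
      using closest_point_lipschitz[OF convex closed nonempty, of y "\<Phi> c"] closest_point_radial_map[OF c(1)]
      by (simp add: p_def k_def h_def dist_norm)
    then have "dist p c < \<delta>" using elim(1) by (simp add: k_def h_def dist_norm)
    note near = near[OF p(1) this]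
    have Np: "N p = \<nu> p" using ext near p(1) by (auto simp: normal_extension_def)
    \<comment> \<open>Expansion of the displacement in normal coordinates: base point, distance, and
      turning of the normal.\<close>
    have hk: "h = k + \<tau> *\<^sub>R \<nu> c + d c *\<^sub>R N' c k + d c *\<^sub>R r1 + \<tau> *\<^sub>R \<Delta>"
      unfolding h_def by (subst p(2)) (simp add: k_def \<tau>_def r1_def \<Delta>_def radial_map_def Np Nc algebra_simps)
    have h\<nu>: "\<nu> c \<bullet> h = r3 + \<tau> + d c * (\<nu> c \<bullet> r1) + \<tau> * (\<nu> c \<bullet> \<Delta>)"
      using normal_extension_tangent[OF ext c(2), of k] c(1)
      by (simp add: hk inner_add_right r3_def inner_commute[of k] Nc)
    have hw: "w \<bullet> h = w \<bullet> k + d c * (w \<bullet> N' c k) + d c * (w \<bullet> r1) + \<tau> * (w \<bullet> \<Delta>)"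
      by (simp add: hk inner_add_right w(2))
    \<comment> \<open>\<open>k\<close> is tangent only up to \<open>r3\<close>; the last term
      corrects for the projection in \<open>normal_map_derivative\<close>.\<close>
    have Dk: "grad_d c \<bullet> k = w \<bullet> k + d c * (w \<bullet> N' c k) - d c * (r3 * (w \<bullet> N' c (\<nu> c)))"
      unfolding w(1)[symmetric]
      by (simp add: normal_map_derivative_apply inner_add_right blinfun.diff_right blinfun.scaleR_right
          inner_diff_right r3_def inner_commute[of "\<nu> c" k] algebra_simps)
    have \<tau>: "\<bar>\<tau>\<bar> \<le> norm h"
    proof -
      have "\<bar>infdist y C - infdist (\<Phi> c) C\<bar> \<le> dist y (\<Phi> c)"
        using infdist_triangle_abs[of y C "\<Phi> c"] .
      moreover have "infdist z C = dist z (closest_point C z)" for z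
        using closed nonempty by (simp add: infdist_eq_setdist setdist_closest_point)
      ultimately show ?thesis
        by (simp add: \<tau>_def p_def h_def dist_norm[of y "\<Phi> c"] closest_point_radial_map[OF c(1)] dist_radial_map[OF c(1)])
    qed
    have "\<eta> * norm k \<le> \<eta> * norm h" using kh \<eta> by (intro mult_left_mono) auto
    then have r: "norm r1 \<le> \<eta> * norm h" "\<bar>r2\<bar> \<le> \<eta> * norm h" "\<bar>r3\<bar> \<le> \<eta> * norm h" "norm \<Delta> \<le> \<eta>"
      using near by (auto simp: r1_def r2_def r3_def \<Delta>_def k_def dist_norm)
    have b1: "\<bar>v \<bullet> r1\<bar> \<le> norm v * (\<eta> * norm h)" for v
      using Cauchy_Schwarz_ineq2[of v r1] mult_left_mono[OF r(1), of "norm v"] by simp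
    have b2: "\<bar>\<tau> * (v \<bullet> \<Delta>)\<bar> \<le> norm v * (\<eta> * norm h)" for v
    proof -
      have "\<bar>v \<bullet> \<Delta>\<bar> \<le> norm v * \<eta>"
        using Cauchy_Schwarz_ineq2[of v \<Delta>] mult_left_mono[OF r(4), of "norm v"] by simp
      then have "\<bar>\<tau>\<bar> * \<bar>v \<bullet> \<Delta>\<bar> \<le> norm h * (norm v * \<eta>)" using \<tau> by (intro mult_mono) auto
      then show ?thesis by (simp add: abs_mult mult_ac)
    qed
    have b3: "\<bar>r3 * (w \<bullet> N' c (\<nu> c))\<bar> \<le> (\<eta> * norm h) * (norm w * norm (N' c (\<nu> c)))"
      unfolding abs_mult by (intro mult_mono r(3) Cauchy_Schwarz_ineq2) (use \<eta> in auto)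
    have d0: "\<bar>d c * x\<bar> \<le> d c * X" if "\<bar>x\<bar> \<le> X" for x X
      using that d by (simp add: abs_mult)
    have "d p - dist y p - (w - \<nu> c) \<bullet> h =
      r2 + r3 + d c * (\<nu> c \<bullet> r1) + \<tau> * (\<nu> c \<bullet> \<Delta>) - d c * (r3 * (w \<bullet> N' c (\<nu> c))) - d c * (w \<bullet> r1) - \<tau> * (w \<bullet> \<Delta>)"
      using Dk hw h\<nu> unfolding r2_def \<tau>_def by (simp add: inner_diff_left)
    also have "\<bar>\<dots>\<bar> \<le> \<eta> * norm h + \<eta> * norm h + d c * (1 * (\<eta> * norm h)) + 1 * (\<eta> * norm h)
      + d c * ((\<eta> * norm h) * (norm w * norm (N' c (\<nu> c)))) + d c * (norm w * (\<eta> * norm h)) + norm w * (\<eta> * norm h)"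
      using r(2,3) d0[OF b1[of "\<nu> c"]] b2[of "\<nu> c"] d0[OF b3] d0[OF b1[of w]] b2[of w] c(1)
      by (simp only: norm_\<nu>)
    also have "\<dots> = (\<eta> * K) * norm h" by (simp add: K_def algebra_simps)
    finally show ?case
      using closest_point_radial_map[OF c(1)] dist_radial_map[OF c(1)]
      by (simp add: \<eta>(2) p_def[symmetric] h_def[symmetric])
  qed
qed

lemma is_inward_normal_domain:
  assumes ext: "normal_extension U N N'" and c: "c \<in> frontier C" "c \<in> U" and d: "d c > 0"
    and w: "\<And>v. w \<bullet> normal_map_derivative (d c) (\<nu> c) (N' c) v = grad_d c \<bullet> v" "w \<bullet> \<nu> c = 0"
  shows "is_inward_normal \<Omega> (\<Phi> c) (sgn (w - \<nu> c))"
proof -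
  have "(w - \<nu> c) \<bullet> \<nu> c \<noteq> 0" using w(2) c(1) by (simp add: inner_diff_left)
  then have "w - \<nu> c \<noteq> 0" by auto
  then show ?thesis
    unfolding sgn_div_norm
  proof (rule is_inward_normal_of_derivative[OF dist_radial_map_derivative[OF assms]])
    show "\<forall>\<^sub>F y in nhds (\<Phi> c). (y \<in> \<Omega>) = (0 < d (closest_point C y) - dist y (closest_point C y))"
      using domain_near_radial_map[OF c(1) d] by (rule eventually_mono) simp
  qed (simp add: closest_point_radial_map[OF c(1)] dist_radial_map[OF c(1)])
qed

section \<open>The return map and its fixed points\<close>

lemma return_map_eq:
  "c \<in> frontier C \<Longrightarrow> F c = \<Phi> c + hitting_time C \<Omega> (\<Phi> c) *\<^sub>R inward_normal \<Omega> (\<Phi> c)"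
  by (simp add: return_map_def reciprocal_map_def)

lemma return_map_zero:
  assumes c: "c \<in> frontier C" and d: "d c = 0"
  shows "F c = c"
proof -
  have "hitting_time C \<Omega> c = 0"
    unfolding hitting_time_def using c frontier_subset by (intro Least_equality) auto
  then show ?thesis using return_map_eq[OF c] d by (simp add: radial_map_def)
qed

lemma fixed_point_iff:
  assumes c: "c \<in> frontier C"
  shows "F c = c \<longleftrightarrow> grad_d c = 0"
proof (cases "d c = 0")
  case True
  then show ?thesis using return_map_zero[OF c] grad_d_zero[OF c] by simp
next
  case False
  then have d: "d c > 0" using thickness_nonneg[OF c] by simp
  obtain U N N' where ext: "normal_extension U N N'" and cU: "c \<in> U" using normal_extension_exists[OF c] .
  obtain w where w: "\<And>v. w \<bullet> normal_map_derivative (d c) (\<nu> c) (N' c) v = grad_d c \<bullet> v"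
    "w \<bullet> \<nu> c = 0" "norm w \<le> norm (grad_d c)"
    using transported_gradient_exists[OF ext c cU thickness_nonneg[OF c] grad_d(1)[OF c]] by metis
  have n: "inward_normal \<Omega> (\<Phi> c) = sgn (w - \<nu> c)"
    using is_inward_normal_domain[OF ext c cU d w(1,2)] by (rule inward_normal_eqI)
  define t where "t = hitting_time C \<Omega> (\<Phi> c)"
  have Fc: "F c = c + d c *\<^sub>R \<nu> c + t *\<^sub>R sgn (w - \<nu> c)"
    using return_map_eq[OF c] unfolding n t_def[symmetric] by (simp add: radial_map_def)
  show ?thesis
  proof
    assume "F c = c"
    then have *: "d c *\<^sub>R \<nu> c + t *\<^sub>R sgn (w - \<nu> c) = 0" using Fc by (simp add: add.assoc)
    have "t / norm (w - \<nu> c) \<noteq> 0"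
      using * d norm_\<nu>[OF c] by (auto simp: sgn_div_norm simp del: norm_\<nu>)
    \<comment> \<open>Since \<open>w\<close> is tangent, pairing the closing condition with
      \<open>w\<close> leaves a nonzero multiple of \<open>w \<bullet> w\<close>.\<close>
    moreover have "w \<bullet> (d c *\<^sub>R \<nu> c + t *\<^sub>R sgn (w - \<nu> c)) = t / norm (w - \<nu> c) * (w \<bullet> w)"
      using w(2) by (simp add: inner_add_right sgn_div_norm inner_diff_right divide_inverse)
    ultimately have "w = 0" using * by simp
    then have "grad_d c \<bullet> grad_d c = 0" using w(1)[of "grad_d c"] by simp
    then show "grad_d c = 0" by simp
  next
    assume "grad_d c = 0"
    then have w0: "w = 0" using w(3) by simp
    then have n': "inward_normal \<Omega> (\<Phi> c) = - \<nu> c" using n c by (simp add: sgn_div_norm)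
    have ray: "\<Phi> c + s *\<^sub>R (- \<nu> c) = c + (d c - s) *\<^sub>R \<nu> c" for s
      by (simp add: radial_map_def algebra_simps)
    \<comment> \<open>The ray runs straight back along the normal ray, whose points at positive
      height are outside \<open>C\<close>, so \<open>c\<close> is the first hit.\<close>
    have "t = d c"
      unfolding t_def hitting_time_def n' ray
    proof (rule Least_equality)
      show "0 \<le> d c \<and> c + (d c - d c) *\<^sub>R \<nu> c \<in> C" using d c frontier_subset by auto
    next
      fix s assume "0 \<le> s \<and> c + (d c - s) *\<^sub>R \<nu> c \<in> C"
      then show "d c \<le> s" using normal_ray_notin[OF c, of "d c - s"] by force
    qed
    then show "F c = c" using Fc w0 c by (simp add: sgn_div_norm)
  qed
qed

end

section \<open>Differentiability of the return map\<close>

lemma eventually_at_within_mem: "eventually (\<lambda>c. c \<in> S) (at x within S)"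
  by (simp add: eventually_at_filter)

lemma has_derivative_eventually_lipschitz:
  assumes "(f has_derivative f') (at x within S)"
  obtains M where "M > 0" "eventually (\<lambda>y. norm (f y - f x) \<le> M * norm (y - x)) (at x within S)"
proof -
  obtain K where K: "K > 0" "\<And>h. norm (f' h) \<le> norm h * K"
    using bounded_linear.pos_bounded[OF has_derivative_bounded_linear[OF assms]] by blast
  have "eventually (\<lambda>y. norm (f y - f x - f' (y - x)) \<le> 1 * norm (y - x)) (at x within S)"
    using assms[unfolded has_derivative_within_alt2, THEN conjunct2, rule_format, of 1] by simp
  then have "eventually (\<lambda>y. norm (f y - f x) \<le> (K + 1) * norm (y - x)) (at x within S)"
  proof eventually_elim
    case (elim y)
    have "norm (f y - f x) \<le> norm (f y - f x - f' (y - x)) + norm (f' (y - x))"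
      by (metis norm_triangle_sub add.commute)
    also have "\<dots> \<le> 1 * norm (y - x) + norm (y - x) * K" using elim K(2) by (intro add_mono)
    finally show ?case by (simp add: algebra_simps)
  qed
  then show ?thesis using that[of "K + 1"] K by simp
qed

lemma has_derivative_perturb:
  assumes g: "(g has_derivative g') (at x within S)"
    and err: "\<And>e. e > 0 \<Longrightarrow> eventually (\<lambda>y. norm (f y - f x - (g y - g x)) \<le> e * norm (y - x)) (at x within S)"
  shows "(f has_derivative g') (at x within S)"
  unfolding has_derivative_within_alt2
proof (intro conjI allI impI has_derivative_bounded_linear[OF g])
  fix e :: real assume "0 < e"
  then have e: "e / 2 > 0" by simp
  have "eventually (\<lambda>y. norm (g y - g x - g' (y - x)) \<le> e / 2 * norm (y - x)) (at x within S)"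
    using g[unfolded has_derivative_within_alt2, THEN conjunct2, rule_format, OF e] .
  then show "eventually (\<lambda>y. norm (f y - f x - g' (y - x)) \<le> e * norm (y - x)) (at x within S)"
    using err[OF e]
  proof eventually_elim
    case (elim y)
    have "f y - f x - g' (y - x) = (f y - f x - (g y - g x)) + (g y - g x - g' (y - x))" by simp
    then have "norm (f y - f x - g' (y - x)) \<le> e / 2 * norm (y - x) + e / 2 * norm (y - x)"
      using elim norm_triangle_le[OF add_mono[OF elim(2,1)]] by metis
    also have "\<dots> = e * norm (y - x)" by (simp add: field_simps)
    finally show ?case .
  qed
qed

text \<open>Here \<open>b = a + \<tau> n\<close> is the displacement of the point where a ray of direction \<open>n\<close>, close to
  \<open>- \<nu>\<close>, meets a surface with normal \<open>\<nu>\<close> at the base point; it is governed by the tangential part of \<open>a\<close>.\<close>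

lemma transversal_hit_estimate:
  fixes a b n \<nu> :: "'a::real_inner"
  assumes \<nu>: "norm \<nu> = 1" and n: "norm n = 1" and b: "b = a + \<tau> *\<^sub>R n"
    and tangent: "\<bar>b \<bullet> \<nu>\<bar> \<le> \<eta> * norm b" and dir: "norm (n + \<nu>) \<le> \<eta>" and \<eta>: "0 \<le> \<eta>" "\<eta> \<le> 1/4"
  shows "norm (b - (a - (a \<bullet> \<nu>) *\<^sub>R \<nu>)) \<le> 10 * \<eta> * norm a"
proof -
  define \<beta> where "\<beta> = n + \<nu>"
  have n\<beta>: "n = \<beta> - \<nu>" and \<beta>: "norm \<beta> \<le> \<eta>" using dir by (auto simp: \<beta>_def)
  have \<nu>\<nu>: "\<nu> \<bullet> \<nu> = 1" using \<nu> by (simp add: dot_square_norm)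
  have \<beta>\<nu>: "\<bar>\<beta> \<bullet> \<nu>\<bar> \<le> \<eta>" using Cauchy_Schwarz_ineq2[of \<beta> \<nu>] \<beta> \<nu> by simp
  have a\<nu>: "\<bar>a \<bullet> \<nu>\<bar> \<le> norm a" using Cauchy_Schwarz_ineq2[of a \<nu>] \<nu> by simp
  have nb: "norm b \<le> norm a + \<bar>\<tau>\<bar>" unfolding b using norm_triangle_ineq[of a "\<tau> *\<^sub>R n"] n by simp
  have "\<eta> * norm b \<le> \<eta> * (norm a + \<bar>\<tau>\<bar>)" using nb \<eta> by (intro mult_left_mono)
  then have b1: "\<bar>b \<bullet> \<nu>\<bar> \<le> \<eta> * (norm a + \<bar>\<tau>\<bar>)" using tangent by linarith
  have "\<eta> * (norm a + \<bar>\<tau>\<bar>) \<le> 1/4 * (norm a + \<bar>\<tau>\<bar>)" using \<eta> by (intro mult_right_mono) auto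
  then have b2: "\<bar>b \<bullet> \<nu>\<bar> \<le> 1/4 * (norm a + \<bar>\<tau>\<bar>)" using b1 by linarith
  have t1: "\<bar>\<tau> * (\<beta> \<bullet> \<nu>)\<bar> \<le> \<bar>\<tau>\<bar> * \<eta>" using \<beta>\<nu> by (simp add: abs_mult mult_left_mono)
  have "\<bar>\<tau>\<bar> * \<eta> \<le> \<bar>\<tau>\<bar> * (1/4)" using \<eta> by (intro mult_left_mono) auto
  then have t2: "\<bar>\<tau> * (\<beta> \<bullet> \<nu>)\<bar> \<le> \<bar>\<tau>\<bar> / 4" using t1 by linarith
  have b\<nu>: "b \<bullet> \<nu> = a \<bullet> \<nu> + \<tau> * (\<beta> \<bullet> \<nu>) - \<tau>"
    by (simp add: b n\<beta> inner_add_left inner_diff_left \<nu>\<nu> algebra_simps)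
  \<comment> \<open>Solving the normal component for \<open>\<tau>\<close> bounds half of
    \<open>\<bar>\<tau>\<bar>\<close> by \<open>5/4 * norm a\<close>.\<close>
  have \<tau>: "\<bar>\<tau>\<bar> \<le> 3 * norm a" 
  proof -
    have "\<bar>\<tau>\<bar> \<le> \<bar>a \<bullet> \<nu>\<bar> + \<bar>\<tau> * (\<beta> \<bullet> \<nu>)\<bar> + \<bar>b \<bullet> \<nu>\<bar>" using b\<nu> by linarith
    then show ?thesis using b2 t2 a\<nu> norm_ge_zero[of a] by argo
  qed
  then have \<eta>\<tau>: "\<bar>\<tau>\<bar> * \<eta> \<le> 3 * norm a * \<eta>" using \<eta> by (intro mult_right_mono)
  \<comment> \<open>What remains costs one \<open>\<eta> * norm a\<close> and three times
    \<open>\<bar>\<tau>\<bar> * \<eta>\<close>; with the bound on \<open>\<tau>\<close> this makes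
    10.\<close>
  have "b - (a - (a \<bullet> \<nu>) *\<^sub>R \<nu>) = (b \<bullet> \<nu> - \<tau> * (\<beta> \<bullet> \<nu>)) *\<^sub>R \<nu> + \<tau> *\<^sub>R \<beta>"
    unfolding b\<nu> by (simp add: b n\<beta> algebra_simps)
  then have "norm (b - (a - (a \<bullet> \<nu>) *\<^sub>R \<nu>)) \<le> \<bar>b \<bullet> \<nu> - \<tau> * (\<beta> \<bullet> \<nu>)\<bar> + \<bar>\<tau>\<bar> * norm \<beta>"
    using norm_triangle_ineq[of "(b \<bullet> \<nu> - \<tau> * (\<beta> \<bullet> \<nu>)) *\<^sub>R \<nu>" "\<tau> *\<^sub>R \<beta>"] \<nu> by simp
  also have "\<dots> \<le> (\<eta> * (norm a + \<bar>\<tau>\<bar>) + \<bar>\<tau>\<bar> * \<eta>) + \<bar>\<tau>\<bar> * \<eta>"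
    using b1 t1 mult_left_mono[OF \<beta>, of "\<bar>\<tau>\<bar>"] by linarith
  also have "\<dots> = \<eta> * norm a + 3 * (\<bar>\<tau>\<bar> * \<eta>)" by (simp add: algebra_simps)
  also have "\<dots> \<le> \<eta> * norm a + 3 * (3 * norm a * \<eta>)" using \<eta>\<tau> by linarith
  also have "\<dots> = 10 * \<eta> * norm a" by (simp add: algebra_simps)
  finally show ?thesis .
qed

context C2_thickness_domain
begin

text \<open>\<open>LEAST\<close> over the reals is informative only when a minimum is attained: the
  hits up to time \<open>s\<close> form a nonempty compact set. Just before the first hit the ray is
  outside \<open>C\<close>, so that hit is not interior.\<close>

lemma hitting_time_bounds:
  assumes s: "s \<ge> 0" "x + s *\<^sub>R inward_normal \<Omega> x \<in> C"
  shows "0 \<le> hitting_time C \<Omega> x" "hitting_time C \<Omega> x \<le> s"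
    "x + hitting_time C \<Omega> x *\<^sub>R inward_normal \<Omega> x \<in> C"
    "x \<notin> C \<Longrightarrow> x + hitting_time C \<Omega> x *\<^sub>R inward_normal \<Omega> x \<in> frontier C"
proof -
  let ?n = "inward_normal \<Omega> x"
  let ?T = "{0..s} \<inter> (\<lambda>t. x + t *\<^sub>R ?n) -` C"
  have "compact ?T"
    by (intro compact_Int_closed compact_Icc continuous_closed_vimage closed) (intro continuous_intros)
  moreover have "s \<in> ?T" using s by simp
  ultimately obtain t where t: "t \<in> ?T" "\<forall>r\<in>?T. t \<le> r"
    using compact_attains_inf[of ?T] by blast
  have least: "t \<le> r" if "0 \<le> r \<and> x + r *\<^sub>R ?n \<in> C" for r
    using that t by (cases "r \<le> s") auto
  have ht: "hitting_time C \<Omega> x = t"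
    unfolding hitting_time_def using t(1) least by (intro Least_equality) auto
  show "0 \<le> hitting_time C \<Omega> x" "hitting_time C \<Omega> x \<le> s" "x + hitting_time C \<Omega> x *\<^sub>R ?n \<in> C"
    unfolding ht using t(1) by auto
  show "x + hitting_time C \<Omega> x *\<^sub>R ?n \<in> frontier C" if "x \<notin> C"
    unfolding ht
  proof -
    have "t > 0" using t(1) that by (cases "t = 0") auto
    have "x + t *\<^sub>R ?n \<notin> interior C"
    proof
      assume "x + t *\<^sub>R ?n \<in> interior C"
      moreover have "((\<lambda>r. x + r *\<^sub>R ?n) \<longlongrightarrow> x + t *\<^sub>R ?n) (at_left t)"
        by (intro tendsto_intros)
      ultimately have "eventually (\<lambda>r. x + r *\<^sub>R ?n \<in> interior C) (at_left t)"
        by (intro topological_tendstoD) auto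
      moreover have "eventually (\<lambda>r. 0 < r \<and> r < t) (at_left t)"
        using eventually_at_left_real[OF \<open>t > 0\<close>] by simp
      ultimately have "eventually (\<lambda>r. False) (at_left t)"
      proof eventually_elim
        case (elim r)
        then show ?case using least[of r] interior_subset[of C] by auto
      qed
      then show False by simp
    qed
    then show "x + t *\<^sub>R ?n \<in> frontier C" using t(1) closed by (simp add: frontier_def)
  qed
qed

text \<open>A pointwise choice over one common extension; differentiability of \<open>w\<close> is
  proved afterwards, at critical points.\<close>

lemma transported_gradient_field:
  assumes ext: "normal_extension U N N'"
  obtains w where
    "\<And>c v. c \<in> frontier C \<inter> U \<Longrightarrow> w c \<bullet> normal_map_derivative (d c) (\<nu> c) (N' c) v = grad_d c \<bullet> v"
    "\<And>c. c \<in> frontier C \<inter> U \<Longrightarrow> norm (w c) \<le> norm (grad_d c)"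
    "\<And>c. \<lbrakk>c \<in> frontier C \<inter> U; d c > 0\<rbrakk> \<Longrightarrow> inward_normal \<Omega> (\<Phi> c) = sgn (w c - \<nu> c)"
proof -
  have "\<forall>c\<in>frontier C \<inter> U. \<exists>w. (\<forall>v. w \<bullet> normal_map_derivative (d c) (\<nu> c) (N' c) v = grad_d c \<bullet> v) \<and>
      w \<bullet> \<nu> c = 0 \<and> norm w \<le> norm (grad_d c)"
  proof
    fix c assume "c \<in> frontier C \<inter> U"
    then have c: "c \<in> frontier C" "c \<in> U" by auto
    show "\<exists>w. (\<forall>v. w \<bullet> normal_map_derivative (d c) (\<nu> c) (N' c) v = grad_d c \<bullet> v) \<and>
      w \<bullet> \<nu> c = 0 \<and> norm w \<le> norm (grad_d c)"
      by (rule transported_gradient_exists[OF ext c thickness_nonneg[OF c(1)] grad_d(1)[OF c(1)]]) auto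
  qed
  from bchoice[OF this] obtain w where w: "\<forall>c\<in>frontier C \<inter> U.
      (\<forall>v. w c \<bullet> normal_map_derivative (d c) (\<nu> c) (N' c) v = grad_d c \<bullet> v) \<and>
      w c \<bullet> \<nu> c = 0 \<and> norm (w c) \<le> norm (grad_d c)"
    by (rule exE)
  show ?thesis
  proof (rule that[of w])
    fix c assume c: "c \<in> frontier C \<inter> U" "d c > 0"
    show "inward_normal \<Omega> (\<Phi> c) = sgn (w c - \<nu> c)"
      by (intro inward_normal_eqI is_inward_normal_domain[OF ext]) (use c w in auto)
  qed (use w in auto)
qed

section \<open>Fixed points of zero thickness\<close>

text \<open>At \<open>c0\<close> both \<open>d\<close> and its gradient vanish, so a deviation of
  \<open>F\<close> from the identity by at most \<open>4 * d\<close> is negligible to first order.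
  Nearby points may have zero or positive thickness.\<close>

lemma return_map_derivative_zero_thickness:
  assumes c: "c0 \<in> frontier C" and d0: "d c0 = 0"
  shows "(F has_derivative (\<lambda>h. h)) (at c0 within frontier C)"
proof (rule has_derivative_perturb[OF has_derivative_ident])
  fix e :: real assume e: "e > 0"
  let ?A = "at c0 within frontier C"
  obtain U N N' where ext: "normal_extension U N N'" and cU: "c0 \<in> U" using normal_extension_exists[OF c] .
  have oU: "open U" and Nd: "(N has_derivative N' c0) (at c0 within frontier C)"
    and N\<nu>: "\<And>p. p \<in> frontier C \<inter> U \<Longrightarrow> N p = \<nu> p"
    using ext cU by (auto simp: normal_extension_def intro: has_derivative_at_withinI)
  obtain w where w: "\<And>c. c \<in> frontier C \<inter> U \<Longrightarrow> norm (w c) \<le> norm (grad_d c)"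
    "\<And>c. \<lbrakk>c \<in> frontier C \<inter> U; d c > 0\<rbrakk> \<Longrightarrow> inward_normal \<Omega> (\<Phi> c) = sgn (w c - \<nu> c)"
    using transported_gradient_field[OF ext] by metis
  have g0: "grad_d c0 = 0" using grad_d_zero[OF c d0] .
  have inU: "eventually (\<lambda>c. c \<in> frontier C \<inter> U) ?A"
    using topological_tendstoD[OF tendsto_ident_at oU cU] eventually_at_within_mem
    by eventually_elim auto
  have gt: "(grad_d \<longlongrightarrow> 0) ?A"
    using differentiable_imp_continuous_within[OF grad_d(3)[OF c]] g0 by (simp add: continuous_within)
  have wt: "(w \<longlongrightarrow> 0) ?A"
    by (rule Lim_null_comparison[OF _ tendsto_norm_zero[OF gt]]) (use inU w(1) in \<open>auto elim: eventually_mono\<close>)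
  have Nt: "(N \<longlongrightarrow> \<nu> c0) ?A"
    using has_derivative_continuous[OF Nd] N\<nu>[of c0] c cU by (simp add: continuous_within)
  \<comment> \<open>At time \<open>3 * d c\<close> the ray from \<open>\<Phi> c\<close> has reached
    \<open>c + d c *\<^sub>R u c\<close>. As \<open>u\<close> tends to \<open>- 2\<close> times the
    outward normal, this direction points inwards; any factor above 1 could replace 3.\<close>
  define u where "u c = N c + 3 *\<^sub>R sgn (w c - N c)" for c
  have "(u \<longlongrightarrow> \<nu> c0 + 3 *\<^sub>R sgn (0 - \<nu> c0)) ?A"
    unfolding u_def by (intro tendsto_intros wt Nt) (use norm_\<nu>[OF c] in auto)
  moreover have "\<nu> c0 + 3 *\<^sub>R sgn (0 - \<nu> c0) = (- 2) *\<^sub>R \<nu> c0"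
    using c scaleR_left_distrib[of 1 "- 3" "\<nu> c0"] by (simp add: sgn_div_norm)
  ultimately have ut: "(u \<longlongrightarrow> (- 2) *\<^sub>R \<nu> c0) ?A" by (simp only:)
  have "((- 2) *\<^sub>R \<nu> c0) \<bullet> \<nu> c0 < 0" using c by simp
  then obtain \<delta> where \<delta>: "\<delta> > 0" "\<And>s. \<lbrakk>0 < s; s < \<delta>\<rbrakk> \<Longrightarrow> c0 + s *\<^sub>R (- 2) *\<^sub>R \<nu> c0 \<in> interior C"
    using inner_cone[OF c] by metis
  define s where "s = \<delta> / 2"
  have s: "s > 0" "c0 + s *\<^sub>R (- 2) *\<^sub>R \<nu> c0 \<in> interior C"
    unfolding s_def by (use \<delta>(1) in simp, intro \<delta>(2)) (use \<delta>(1) in auto)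
  have "((\<lambda>c. c + s *\<^sub>R u c) \<longlongrightarrow> c0 + s *\<^sub>R (- 2) *\<^sub>R \<nu> c0) ?A"
    by (intro tendsto_intros ut)
  from topological_tendstoD[OF this open_interior s(2)]
  have ev1: "eventually (\<lambda>c. c + s *\<^sub>R u c \<in> interior C) ?A" .
  have ev2: "eventually (\<lambda>c. d c < s) ?A"
    using order_tendstoD(2)[OF continuous_thickness[OF c]] d0 s(1) by simp
  \<comment> \<open>The 4 is one \<open>d\<close> for going out to \<open>\<Phi>\<close> and three
    for the way back.\<close>
  have "e / 4 > 0" using e by simp
  then have ev3: "eventually (\<lambda>c. norm (d c - d c0 - grad_d c0 \<bullet> (c - c0)) \<le> e / 4 * norm (c - c0)) ?A"
    using grad_d(2)[OF c, unfolded has_derivative_within_alt2, THEN conjunct2, rule_format] by blast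
  show "eventually (\<lambda>y. norm (F y - F c0 - (y - c0)) \<le> e * norm (y - c0)) ?A"
    using inU ev1 ev2 ev3
  proof eventually_elim
    case (elim y)
    have y: "y \<in> frontier C" and dy: "d y \<ge> 0" using elim(1) thickness_nonneg by auto
    have "norm (F y - y) \<le> 4 * d y"
    proof (cases "d y = 0")
      case False
      then have dpos: "d y > 0" using dy by simp
      let ?n = "inward_normal \<Omega> (\<Phi> y)"
      have n: "?n = sgn (w y - N y)" using w(2)[OF elim(1) dpos] N\<nu>[OF elim(1)] by simp
      have nn: "norm ?n \<le> 1" unfolding n by (simp add: norm_sgn)
      \<comment> \<open>The point \<open>y + s *\<^sub>R u y\<close> lies in \<open>C\<close> for a
        fixed step \<open>s\<close>; convexity passes this down to the shorter step
        \<open>d y\<close>.\<close>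
      have "(1 - d y / s) *\<^sub>R y + (d y / s) *\<^sub>R (y + s *\<^sub>R u y) \<in> C"
        using convex y elim(2,3) s(1) dpos frontier_subset interior_subset
        by (intro convexD) auto
      moreover have "(1 - d y / s) *\<^sub>R y + (d y / s) *\<^sub>R (y + s *\<^sub>R u y) = \<Phi> y + (3 * d y) *\<^sub>R ?n"
        unfolding n using s(1) N\<nu>[OF elim(1)] by (simp add: u_def radial_map_def algebra_simps)
      ultimately have hit: "\<Phi> y + (3 * d y) *\<^sub>R ?n \<in> C" by simp
      let ?t = "hitting_time C \<Omega> (\<Phi> y)"
      have t: "0 \<le> ?t" "?t \<le> 3 * d y" using hitting_time_bounds[OF _ hit] dpos by auto
      have "F y - y = d y *\<^sub>R \<nu> y + ?t *\<^sub>R ?n"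
        using return_map_eq[OF y] by (simp add: radial_map_def)
      then have "norm (F y - y) \<le> norm (d y *\<^sub>R \<nu> y) + norm (?t *\<^sub>R ?n)"
        by (simp only: norm_triangle_ineq)
      also have "\<dots> \<le> d y + 3 * d y * 1"
      proof (rule add_mono)
        have "\<bar>?t\<bar> * norm ?n \<le> 3 * d y * 1" using t nn by (intro mult_mono) auto
        then show "norm (?t *\<^sub>R ?n) \<le> 3 * d y * 1" by (simp only: norm_scaleR)
      qed (use dpos y in simp)
      finally show ?thesis by simp
    qed (use return_map_zero[OF y] in simp)
    moreover have "d y \<le> e / 4 * norm (y - c0)" using elim(4) g0 d0 dy by simp
    ultimately show ?case using return_map_zero[OF c d0] by simp
  qed
qed

section \<open>Fixed points of positive thickness\<close>

lemma transported_gradient_differentiable: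
  assumes ext: "normal_extension U N N'" and c: "c0 \<in> frontier C" "c0 \<in> U" and g0: "grad_d c0 = 0"
    and w: "\<And>c v. c \<in> frontier C \<inter> U \<Longrightarrow> w c \<bullet> normal_map_derivative (d c) (\<nu> c) (N' c) v = grad_d c \<bullet> v"
    "\<And>c. c \<in> frontier C \<inter> U \<Longrightarrow> norm (w c) \<le> norm (grad_d c)"
  obtains L where "(w has_derivative L) (at c0 within frontier C)"
proof -
  let ?A = "at c0 within frontier C"
  have oU: "open U" and Nd: "(N has_derivative N' c0) ?A"
    and N\<nu>: "\<And>p. p \<in> frontier C \<inter> U \<Longrightarrow> N p = \<nu> p"
    and N'cont: "continuous_on U N'"
    using ext c by (auto simp: normal_extension_def intro: has_derivative_at_withinI)
  define B where "B c = normal_map_derivative (d c) (N c) (N' c)" for c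
  have inU: "eventually (\<lambda>c. c \<in> frontier C \<inter> U) ?A"
    using topological_tendstoD[OF tendsto_ident_at oU c(2)] eventually_at_within_mem
    by eventually_elim auto
  obtain D where D: "(grad_d has_derivative D) ?A"
    using grad_d(3)[OF c(1)] by (auto simp: differentiable_def)
  obtain R where R: "linear R" "\<And>y v. R y \<bullet> B c0 v = y \<bullet> v"
    using normal_map_derivative_adjoint_inverse[OF ext c thickness_nonneg[OF c(1)]] N\<nu>[of c0] c
    unfolding B_def by (metis IntI)
  have w0: "w c0 = 0" using w(2)[of c0] c g0 by simp
  obtain M where M: "M > 0" "eventually (\<lambda>y. norm (grad_d y - grad_d c0) \<le> M * norm (y - c0)) ?A"
    using has_derivative_eventually_lipschitz[OF D] .
  have Bt: "(B \<longlongrightarrow> B c0) ?A"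
  proof -
    have "(N' \<longlongrightarrow> N' c0) (at c0)"
      using N'cont oU c(2) by (simp add: continuous_on_eq_continuous_at isCont_def)
    then have "(N' \<longlongrightarrow> N' c0) ?A" by (rule tendsto_within_subset) simp
    moreover have "(N \<longlongrightarrow> N c0) ?A"
      using has_derivative_continuous[OF Nd] by (simp add: continuous_within)
    ultimately show ?thesis
      unfolding B_def normal_map_derivative_def blinfun_tangent_def
      by (intro tendsto_intros continuous_thickness c bounded_linear.tendsto[OF bounded_linear_blinfun_scaleR_left]
          bounded_linear.tendsto[OF bounded_linear_blinfun_inner_right])
  qed
  have "(w has_derivative (\<lambda>h. R (D h))) ?A"
    unfolding has_derivative_within_alt2
  proof (intro conjI allI impI)
    show "bounded_linear (\<lambda>h. R (D h))"
      using bounded_linear_compose[OF linear_conv_bounded_linear[THEN iffD1, OF R(1)]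
          has_derivative_bounded_linear[OF D]] .
  next
    fix e :: real assume e: "e > 0"
    then have e2: "e / 2 > 0" "e / (2 * M) > 0" using M by auto
    have "eventually (\<lambda>y. norm (grad_d y - grad_d c0 - D (y - c0)) \<le> e / 2 * norm (y - c0)) ?A"
      using D[unfolded has_derivative_within_alt2, THEN conjunct2, rule_format, OF e2(1)] .
    then show "eventually (\<lambda>y. norm (w y - w c0 - R (D (y - c0))) \<le> e * norm (y - c0)) ?A"
      using M(2) tendstoD[OF Bt e2(2)] inU
    proof eventually_elim
      case (elim y)
      let ?h = "y - c0"
      \<comment> \<open>The error is tested against itself: coercivity of \<open>B c0\<close> bounds
        its square by a small factor times \<open>norm v\<close>.\<close>
      define v where "v = w y - R (D ?h)"
      have wy: "norm (w y) \<le> M * norm ?h" using w(2)[OF elim(4)] elim(2) g0 by simp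
      have BB: "norm (B c0 - B y) \<le> e / (2 * M)"
        using elim(3) by (simp add: dist_norm norm_minus_commute)
      have "(norm v)\<^sup>2 \<le> v \<bullet> B c0 v"
        unfolding B_def using normal_map_derivative_coercive[OF ext c thickness_nonneg[OF c(1)]] N\<nu>[of c0] c by simp
      also have "\<dots> = w y \<bullet> B y v + w y \<bullet> (B c0 - B y) v - D ?h \<bullet> v"
      proof -
        have "v \<bullet> x = w y \<bullet> x - R (D ?h) \<bullet> x" for x by (simp add: v_def inner_diff_left)
        then show ?thesis by (simp add: R(2) blinfun.diff_left inner_diff_right)
      qed
      also have "w y \<bullet> B y v = grad_d y \<bullet> v"
        unfolding B_def using w(1)[OF elim(4)] N\<nu>[OF elim(4)] by simp
      also have "grad_d y \<bullet> v + w y \<bullet> (B c0 - B y) v - D ?h \<bullet> v =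
        (grad_d y - grad_d c0 - D ?h) \<bullet> v + w y \<bullet> (B c0 - B y) v"
        by (simp add: g0 inner_diff_left)
      also have "\<dots> \<le> (e / 2 * norm ?h) * norm v + (M * norm ?h) * (e / (2 * M) * norm v)"
      proof (rule add_mono)
        show "(grad_d y - grad_d c0 - D ?h) \<bullet> v \<le> (e / 2 * norm ?h) * norm v"
          using norm_cauchy_schwarz[of "grad_d y - grad_d c0 - D ?h" v] mult_right_mono[OF elim(1), of "norm v"]
          by simp
        have "norm ((B c0 - B y) v) \<le> e / (2 * M) * norm v"
          using norm_blinfun[of "B c0 - B y" v] mult_right_mono[OF BB, of "norm v"] by simp
        then have "norm (w y) * norm ((B c0 - B y) v) \<le> (M * norm ?h) * (e / (2 * M) * norm v)"
          using wy by (intro mult_mono) (use M(1) in auto)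
        then show "w y \<bullet> (B c0 - B y) v \<le> (M * norm ?h) * (e / (2 * M) * norm v)"
          using norm_cauchy_schwarz[of "w y" "(B c0 - B y) v"] by linarith
      qed
      also have "\<dots> = (e * norm ?h) * norm v" using M(1) by (simp add: field_simps)
      finally have "norm v \<le> e * norm ?h"
        using e by (cases "v = 0") (auto simp: power2_eq_square)
      then show ?case by (simp add: v_def w0)
    qed
  qed
  then show ?thesis by (rule that)
qed

lemma return_map_differentiable_pos_thickness:
  assumes c: "c0 \<in> frontier C" and d0: "d c0 > 0" and g0: "grad_d c0 = 0"
  shows "F differentiable (at c0 within frontier C)"
proof -
  let ?A = "at c0 within frontier C"
  obtain U N N' where ext: "normal_extension U N N'" and cU: "c0 \<in> U" using normal_extension_exists[OF c] .
  have oU: "open U" and Nd: "(N has_derivative N' c0) ?A"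
    and N\<nu>: "\<And>p. p \<in> frontier C \<inter> U \<Longrightarrow> N p = \<nu> p"
    using ext cU by (auto simp: normal_extension_def intro: has_derivative_at_withinI)
  have N0: "N c0 = \<nu> c0" using N\<nu> c cU by simp
  obtain w where w:
    "\<And>c v. c \<in> frontier C \<inter> U \<Longrightarrow> w c \<bullet> normal_map_derivative (d c) (\<nu> c) (N' c) v = grad_d c \<bullet> v"
    "\<And>c. c \<in> frontier C \<inter> U \<Longrightarrow> norm (w c) \<le> norm (grad_d c)"
    "\<And>c. \<lbrakk>c \<in> frontier C \<inter> U; d c > 0\<rbrakk> \<Longrightarrow> inward_normal \<Omega> (\<Phi> c) = sgn (w c - \<nu> c)"
    using transported_gradient_field[OF ext] by metis
  obtain L where L: "(w has_derivative L) ?A"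
    by (rule transported_gradient_differentiable[OF ext c cU g0 w(1,2)])
  have w0: "w c0 = 0" using w(2)[of c0] c cU g0 by simp
  have \<nu>0: "\<nu> c0 \<noteq> 0" using norm_\<nu>[OF c] by force
  define n where "n c = sgn (w c - N c)" for c
  define X where "X c = c + d c *\<^sub>R N c" for c
  define G where "G c = X c + d c0 *\<^sub>R n c" for c
  have n0: "n c0 = - \<nu> c0" using c by (simp add: n_def w0 N0 sgn_div_norm)
  have "(n has_derivative (\<lambda>h. ((L h - N' c0 h) - (sgn (w c0 - N c0) \<bullet> (L h - N' c0 h)) *\<^sub>R sgn (w c0 - N c0))
      /\<^sub>R norm (w c0 - N c0))) ?A"
    unfolding n_def
    by (rule has_derivative_compose[OF has_derivative_diff[OF L Nd] has_derivative_sgn])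
      (simp add: w0 N0 \<nu>0)
  then obtain n' where n': "(n has_derivative n') ?A" by blast
  have "(G has_derivative (\<lambda>h. (h + (d c0 *\<^sub>R N' c0 h + (grad_d c0 \<bullet> h) *\<^sub>R N c0)) + d c0 *\<^sub>R n' h)) ?A"
    unfolding G_def X_def
    by (intro has_derivative_add has_derivative_scaleR has_derivative_ident has_derivative_scaleR_right
        grad_d(2)[OF c] Nd n')
  then obtain G' where G': "(G has_derivative G') ?A" by blast
  obtain M where M: "M > 0" "eventually (\<lambda>y. norm (G y - G c0) \<le> M * norm (y - c0)) ?A"
    using has_derivative_eventually_lipschitz[OF G'] .
  have G0: "G c0 = c0" by (simp add: G_def X_def n0 N0)
  have nt: "(n \<longlongrightarrow> - \<nu> c0) ?A"
    using has_derivative_continuous[OF n'] by (simp add: continuous_within n0)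
  have Nt: "(N \<longlongrightarrow> \<nu> c0) ?A"
    using has_derivative_continuous[OF Nd] by (simp add: continuous_within N0)
  have Xt: "(X \<longlongrightarrow> c0 + d c0 *\<^sub>R \<nu> c0) ?A"
    unfolding X_def by (intro tendsto_intros Nt continuous_thickness[OF c])
  define t where "t c = hitting_time C \<Omega> (\<Phi> c)" for c
  have nu_neg: "- \<nu> c0 \<noteq> 0" using \<nu>0 by simp
  have good: "eventually (\<lambda>c. c \<in> frontier C \<and> d c > 0 \<and> \<Phi> c = X c \<and> inward_normal \<Omega> (\<Phi> c) = n c \<and>
      norm (n c) = 1) ?A"
    using topological_tendstoD[OF tendsto_ident_at oU cU] eventually_at_within_mem
      order_tendstoD(1)[OF continuous_thickness[OF c] d0]
      tendsto_imp_eventually_ne[OF nt nu_neg]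
  proof eventually_elim
    case (elim y)
    then have "n y \<noteq> 0" using \<nu>0 by simp
    then show ?case using elim N\<nu>[of y] w(3)[of y]
      by (auto simp: n_def X_def radial_map_def norm_sgn)
  qed
  have "- \<nu> c0 \<bullet> \<nu> c0 < 0" using c by simp
  then obtain \<delta> where \<delta>: "\<delta> > 0" "\<And>s. \<lbrakk>0 < s; s < \<delta>\<rbrakk> \<Longrightarrow> c0 + s *\<^sub>R (- \<nu> c0) \<in> interior C"
    using inner_cone[OF c] by metis
  \<comment> \<open>Overshooting by \<open>s\<close> ends near an interior point below
    \<open>c0\<close>, so nearby rays do meet \<open>C\<close>, at the latest at that time.\<close>
  have hits: "eventually (\<lambda>c. X c + (d c0 + s) *\<^sub>R n c \<in> C) ?A" if s: "0 < s" "s < \<delta>" for s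
  proof -
    have "((\<lambda>c. X c + (d c0 + s) *\<^sub>R n c) \<longlongrightarrow> (c0 + d c0 *\<^sub>R \<nu> c0) + (d c0 + s) *\<^sub>R (- \<nu> c0)) ?A"
      by (intro tendsto_intros Xt nt)
    moreover have "(c0 + d c0 *\<^sub>R \<nu> c0) + (d c0 + s) *\<^sub>R (- \<nu> c0) = c0 + s *\<^sub>R (- \<nu> c0)"
      by (simp add: algebra_simps)
    ultimately have "((\<lambda>c. X c + (d c0 + s) *\<^sub>R n c) \<longlongrightarrow> c0 + s *\<^sub>R (- \<nu> c0)) ?A"
      by (simp only:)
    from topological_tendstoD[OF this open_interior \<delta>(2)[OF s]]
    show ?thesis by (rule eventually_mono) (use interior_subset in blast)
  qed
  have half: "0 < \<delta> / 2" "\<delta> / 2 < \<delta>" using \<delta>(1) by auto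
  have hit: "eventually (\<lambda>c. 0 \<le> t c \<and> X c + t c *\<^sub>R n c = F c \<and> F c \<in> frontier C) ?A"
    using hits[OF half] good
  proof eventually_elim
    case (elim y)
    have "\<Phi> y \<notin> C" using elim normal_ray_notin[of y "d y"] by (simp add: radial_map_def)
    moreover have y: "\<Phi> y = X y" "inward_normal \<Omega> (X y) = n y" "y \<in> frontier C" using elim by auto
    ultimately show ?case
      using hitting_time_bounds[of "d c0 + \<delta> / 2" "X y"] d0 \<delta>(1) elim(1) return_map_eq[OF y(3)]
      by (simp add: t_def y(1,2))
  qed
  have tt: "(t \<longlongrightarrow> d c0) ?A"
  proof (rule order_tendstoI)
    fix a assume a: "a < d c0"
    have "((\<lambda>c. (X c - c0) \<bullet> \<nu> c0) \<longlongrightarrow> (c0 + d c0 *\<^sub>R \<nu> c0 - c0) \<bullet> \<nu> c0) ?A"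
      by (intro tendsto_intros Xt)
    then have "((\<lambda>c. (X c - c0) \<bullet> \<nu> c0) \<longlongrightarrow> d c0) ?A" using c by simp
    from order_tendstoD(1)[OF this a] hit good show "eventually (\<lambda>c. a < t c) ?A"
    proof eventually_elim
      case (elim y)
      \<comment> \<open>The landing point is below the supporting hyperplane at \<open>c0\<close>,
        and the height above it decreases at speed at most 1.\<close>
      have "(X y + t y *\<^sub>R n y - c0) \<bullet> \<nu> c0 \<le> 0"
        using elim frontier_subset by (intro supporting[OF c]) auto
      then have "(X y - c0) \<bullet> \<nu> c0 + t y * (n y \<bullet> \<nu> c0) \<le> 0"
        by (simp add: inner_diff_left inner_add_left)
      moreover have "- 1 \<le> n y \<bullet> \<nu> c0"
        using Cauchy_Schwarz_ineq2[of "n y" "\<nu> c0"] elim c by simp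
      then have "t y * (- 1) \<le> t y * (n y \<bullet> \<nu> c0)" using elim by (intro mult_left_mono) auto
      ultimately show ?case using elim(1) by linarith
    qed
  next
    fix a assume a: "d c0 < a"
    define s where "s = min (\<delta> / 2) ((a - d c0) / 2)"
    have s: "0 < s" "s < \<delta>" "d c0 + s < a" using \<delta>(1) a by (auto simp: s_def min_def field_simps)
    show "eventually (\<lambda>c. t c < a) ?A"
      using hits[OF s(1,2)] good
    proof eventually_elim
      case (elim y)
      then have "\<Phi> y = X y" "inward_normal \<Omega> (X y) = n y" by auto
      then show ?case using hitting_time_bounds(2)[of "d c0 + s" "X y"] d0 s elim(1) by (simp add: t_def)
    qed
  qed
  have Ft: "(F \<longlongrightarrow> c0) ?A"
  proof -
    have "((\<lambda>c. X c + t c *\<^sub>R n c) \<longlongrightarrow> c0 + d c0 *\<^sub>R \<nu> c0 + d c0 *\<^sub>R (- \<nu> c0)) ?A"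
      by (intro tendsto_intros Xt tt nt)
    then have "((\<lambda>c. X c + t c *\<^sub>R n c) \<longlongrightarrow> c0) ?A" by simp
    moreover have "eventually (\<lambda>c. X c + t c *\<^sub>R n c = F c) ?A" using hit by (rule eventually_mono) simp
    ultimately show ?thesis by (rule Lim_transform_eventually)
  qed
  define P where "P x = x - (x \<bullet> \<nu> c0) *\<^sub>R \<nu> c0" for x
  have Pbl: "bounded_linear P"
    unfolding P_def
    by (intro bounded_linear_sub bounded_linear_ident bounded_linear_compose[OF bounded_linear_scaleR_left]
        bounded_linear_inner_left)
  have F0: "F c0 = c0" using fixed_point_iff[OF c] g0 by simp
  have "(F has_derivative (\<lambda>h. P (G' h))) ?A"
  proof (rule has_derivative_perturb[OF bounded_linear.has_derivative[OF Pbl G']])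
    fix e :: real assume e: "e > 0"
    \<comment> \<open>\<open>1/4\<close> is the range of \<open>transversal_hit_estimate\<close>;
      \<open>10 * M\<close> combines its constant with the Lipschitz bound for \<open>G\<close> at
      \<open>c0\<close>.\<close>
    define \<eta> where "\<eta> = min (1/4) (e / (10 * M))"
    have \<eta>: "\<eta> > 0" "\<eta> \<le> 1/4" "\<eta> \<le> e / (10 * M)" using e M by (auto simp: \<eta>_def)
    have "eventually (\<lambda>y. F y \<in> frontier C \<longrightarrow> \<bar>(F y - c0) \<bullet> \<nu> c0\<bar> \<le> \<eta> * norm (F y - c0)) ?A"
      using eventually_compose_filterlim[OF frontier_tangent[OF c \<eta>(1)] Ft] .
    then show "eventually (\<lambda>y. norm (F y - F c0 - (P (G y) - P (G c0))) \<le> e * norm (y - c0)) ?A"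
      using hit good M(2) tendstoD[OF nt \<eta>(1)]
    proof eventually_elim
      case (elim y)
      have "norm (F y - c0 - (G y - c0 - ((G y - c0) \<bullet> \<nu> c0) *\<^sub>R \<nu> c0)) \<le> 10 * \<eta> * norm (G y - c0)"
      proof (rule transversal_hit_estimate[where n = "n y" and \<tau> = "t y - d c0"])
        have "F y = X y + t y *\<^sub>R n y" using elim by simp
        then show "F y - c0 = G y - c0 + (t y - d c0) *\<^sub>R n y"
          by (simp add: G_def algebra_simps)
      qed (use elim c \<eta> in \<open>auto simp: dist_norm\<close>)
      also have "\<dots> \<le> 10 * \<eta> * (M * norm (y - c0))"
        using elim G0 \<eta> by (intro mult_left_mono) auto
      also have "\<dots> = (10 * M * \<eta>) * norm (y - c0)" by simp
      also have "\<dots> \<le> e * norm (y - c0)"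
        using \<eta>(3) M(1) by (intro mult_right_mono) (simp_all add: field_simps)
      finally show ?case
        by (simp add: F0 G0 P_def inner_diff_left algebra_simps)
    qed
  qed
  then show ?thesis by (auto simp: differentiable_def)
qed

lemma return_map_differentiable_fixed_point:
  assumes "c \<in> frontier C" "F c = c"
  shows "F differentiable (at c within frontier C)"
proof (cases "d c = 0")
  case True
  then show ?thesis
    using return_map_derivative_zero_thickness[OF assms(1)] by (auto simp: differentiable_def)
next
  case False
  then show ?thesis
    using return_map_differentiable_pos_thickness[OF assms(1)] thickness_nonneg[OF assms(1)]
      fixed_point_iff[OF assms(1)] assms(2) by simp
qed

section \<open>Critical set and basins\<close>

lemma fixed_points_eq: "fixed_points C F = critical_points C d"
  using fixed_point_iff by (auto simp: fixed_points_def critical_points_def)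

text \<open>Critical points are fixed, so each basin contains its own point and is nonempty;
  uniqueness of limits makes distinct basins disjoint.\<close>

lemma partition_basin_decomposition:
  "partition_on (frontier C) (basin_decomposition C d F)"
proof -
  have self: "p \<in> basin C F p" if "p \<in> critical_points C d" for p
  proof -
    have p: "F p = p" "p \<in> frontier C" using that unfolding fixed_points_eq[symmetric] by (auto simp: fixed_points_def)
    have "(F ^^ n) p = p" for n by (induction n) (simp_all add: p)
    then show ?thesis using p(2) by (simp add: basin_def)
  qed
  have disj: "p = q" if "x \<in> basin C F p" "x \<in> basin C F q" for p q x
    using that LIMSEQ_unique by (auto simp: basin_def)
  have sub: "basin C F p \<subseteq> frontier C" for p by (auto simp: basin_def)
  let ?B = "basin C F ` critical_points C d"
  show ?thesis
    unfolding basin_decomposition_def Let_def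
  proof (rule partition_onI)
    have "\<Union> ?B \<subseteq> frontier C" using sub by blast
    then show "\<Union> (?B \<union> ({frontier C - \<Union> ?B} - {{}})) = frontier C"
      by (simp only: Union_Un_distrib) blast
    show "{} \<notin> ?B \<union> ({frontier C - \<Union> ?B} - {{}})"
      using self by auto
    show "disjnt p q" if "p \<in> ?B \<union> ({frontier C - \<Union> ?B} - {{}})"
      "q \<in> ?B \<union> ({frontier C - \<Union> ?B} - {{}})" "p \<noteq> q" for p q
      using that disj by (auto simp: disjnt_def)
  qed
qed

end

theorem theorem6p1:
  fixes C \<Omega> :: "'a::euclidean_space set"
  assumes "convex_core C"
    and "\<Omega> \<in> class_O C"
    and "C2_thickness C \<Omega>"
  shows
    "(fixed_points C (return_map C \<Omega>) = critical_points C (thickness C \<Omega>) \<and>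
      return_map_determines C \<Omega> (\<lambda>\<Omega>. critical_points C (thickness C \<Omega>))) \<and>
     ((\<forall>p\<in>fixed_points C (return_map C \<Omega>).
         return_map C \<Omega> differentiable (at p within frontier C)) \<and>
      return_map_determines C \<Omega>
        (\<lambda>\<Omega>. restrict (stability_type C (return_map C \<Omega>)) (fixed_points C (return_map C \<Omega>)))) \<and>
     (partition_on (frontier C) (basin_decomposition C (thickness C \<Omega>) (return_map C \<Omega>)) \<and>
      return_map_determines C \<Omega>
        (\<lambda>\<Omega>. basin_decomposition C (thickness C \<Omega>) (return_map C \<Omega>)))"
proof -
  interpret C2_thickness_domain C \<Omega> using assms by unfold_locales
  \<comment> \<open>Both critical sets are the fixed point set of the common return map.\<close>
  have same: "critical_points C (thickness C \<Omega>') = critical_points C (thickness C \<Omega>)"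
    if "\<Omega>' \<in> class_O C" "C2_thickness C \<Omega>'" "return_map C \<Omega>' = return_map C \<Omega>" for \<Omega>'
  proof -
    interpret other: C2_thickness_domain C \<Omega>' using assms(1) that(1,2) by unfold_locales
    show ?thesis using fixed_points_eq other.fixed_points_eq that(3) by simp
  qed
  then show ?thesis
    using fixed_points_eq return_map_differentiable_fixed_point partition_basin_decomposition
    by (auto simp: return_map_determines_def basin_decomposition_def fixed_points_def)
qed

end
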